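(* Let $\mathbb F$ be a field, let $H$ be the Faà di Bruno coloop bialgebra over $\mathbb F$, with comultiplication $\Delta:H\to H\amalg H$, and let $\pi:H\amalg H\to H\otimes H$ be the canonical projection. Then the image $H^{\otimes}$ of $H$ under the canonical projection, i.e. the algebra $H$ with comultiplication $\Delta^\otimes=\pi\Delta$, counit $\varepsilon$, and the antipode given on generators by that of $H$, is the non-commutative Faà di Bruno Hopf algebra: $H^{\otimes}=H^{nc}_{FdB}$.
   Context: $H=\mathbb F\langle x_n,\ n\ge1\rangle$ is the free unital associative algebra ($x_0=1$), and $H\amalg H=\mathbb F\langle x_n,y_n,\ n\ge1\rangle$ is the coproduct (free product) of unital associative algebras, $x_n$ and $y_n$ being the generator $x_n$ in the first and second copy. $\mathcal C_n^{\ell}$ is the set of compositions of $n$ into $\ell$ positive integers. The comultiplication is the algebra homomorphism with $\Delta(x_n)=x_n+y_n+\sum_{\ell=1}^{n-1}\sum_{\mathbf n\in\mathcal C_n^{\ell+1}}\binom{n_1+1}{\ell}x_{n_1}y_{n_2}\cdots y_{n_{\ell+1}}$, and the counit is $\varepsilon(x_n)=0$ for $n\ge1$. The antipode of the coloop bialgebra is the unique algebra homomorphism $S:H\to H$ with $\mu(S\amalg \mathrm{id})\Delta=\mu(\mathrm{id}\amalg S)\Delta=u\varepsilon$, where $\mu=\langle\mathrm{id},\mathrm{id}\rangle:H\amalg H\to H$ is the folding homomorphism and $u:\mathbb F\to H$ the unit. The canonical projection $\pi:H\amalg H\to H\otimes H$ is the algebra homomorphism induced by $j_1(h)=h\otimes1$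 and $j_2(h)=1\otimes h$, where $H\otimes H$ has the componentwise product. The non-commutative Faà di Bruno Hopf algebra is $H^{nc}_{FdB}=\mathbb F\langle x_n,\ n\ge1\rangle$ ($x_0=1$) with comultiplication the algebra homomorphism $\Delta^{nc}(x_n)=\sum_{m=0}^nx_m\otimes\sum_{k_0+\cdots+k_m=n-m,\ k_i\ge0}x_{k_0}\cdots x_{k_m}$ and counit $\varepsilon(x_n)=0$ for $n\ge1$; it is a (usual) Hopf algebra, with its unique Hopf antipode (which is an algebra anti-homomorphism). *)

theory Defs
  imports Complex_Main "HOL-Library.Poly_Mapping" "HOL-Library.Product_Plus"
begin

section \<open>Free monoids and their monoid algebras\<close>

datatype 'a fmon = Word (letters: "'a list")

text \<open>
  The free monoid is written additively, because the product of \<open>'m \<Rightarrow>\<^sub>0 'f\<close> is convolution with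
  respect to addition of keys.  Thus for a field \<open>'f\<close> the type \<open>'m \<Rightarrow>\<^sub>0 'f\<close> is the monoid algebra
  of \<open>'m\<close>; in particular

  \<^item> \<open>'a fmon \<Rightarrow>\<^sub>0 'f\<close> is the free unital associative algebra on \<open>'a\<close>;
  \<^item> \<open>('a + 'b) fmon \<Rightarrow>\<^sub>0 'f\<close> is the coproduct of the free algebras on \<open>'a\<close> and on \<open>'b\<close>;
  \<^item> \<open>'m \<times> 'n \<Rightarrow>\<^sub>0 'f\<close>, whose basis consists of the pairs of basis elements and whose product is
    componentwise, is the tensor product of the algebras \<open>'m \<Rightarrow>\<^sub>0 'f\<close> and \<open>'n \<Rightarrow>\<^sub>0 'f\<close>.

  The universal properties of these models are the lemmas \<open>free_lift_unique\<close>,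
  \<open>coprod_lift_unique\<close>, \<open>tensor_mult\<close> and \<open>tensor_lift_unique\<close> below.
\<close>

instantiation fmon :: (type) monoid_add
begin

definition zero_fmon :: "'a fmon" where
  "0 = Word []"

definition plus_fmon :: "'a fmon \<Rightarrow> 'a fmon \<Rightarrow> 'a fmon" where
  "u + v = Word (letters u @ letters v)"

instance
  by standard (simp_all add: zero_fmon_def plus_fmon_def)

end

definition pscale :: "'f::field \<Rightarrow> ('m \<Rightarrow>\<^sub>0 'f) \<Rightarrow> ('m \<Rightarrow>\<^sub>0 'f)" where
  "pscale c = Poly_Mapping.map ((*) c)"

lemma lookup_pscale [simp]: "Poly_Mapping.lookup (pscale c p) k = c * Poly_Mapping.lookup p k"
  unfolding pscale_def by transfer (simp add: when_def)

lemma vector_space_pscale: "vector_space pscale"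
  by unfold_locales (auto intro!: poly_mapping_eqI simp: lookup_add algebra_simps)

lemma vector_space_times: "vector_space ((*) :: 'f::field \<Rightarrow> _)"
  by unfold_locales (simp_all add: algebra_simps)

text \<open>
  Homomorphisms between unital algebras given by ring types together with scalar
  multiplications \<open>s\<close> and \<open>t\<close>.
\<close>

definition alg_hom ::
    "('f::field \<Rightarrow> 'a::ring_1 \<Rightarrow> 'a) \<Rightarrow> ('f \<Rightarrow> 'b::ring_1 \<Rightarrow> 'b) \<Rightarrow> ('a \<Rightarrow> 'b) \<Rightarrow> bool" where
  "alg_hom s t \<phi> \<longleftrightarrow>
    Vector_Spaces.linear s t \<phi> \<and> \<phi> 1 = 1 \<and> (\<forall>a b. \<phi> (a * b) = \<phi> a * \<phi> b)"

definition alg_antihom ::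
    "('f::field \<Rightarrow> 'a::ring_1 \<Rightarrow> 'a) \<Rightarrow> ('f \<Rightarrow> 'b::ring_1 \<Rightarrow> 'b) \<Rightarrow> ('a \<Rightarrow> 'b) \<Rightarrow> bool" where
  "alg_antihom s t \<phi> \<longleftrightarrow>
    Vector_Spaces.linear s t \<phi> \<and> \<phi> 1 = 1 \<and> (\<forall>a b. \<phi> (a * b) = \<phi> b * \<phi> a)"

abbreviation basis :: "'m \<Rightarrow> ('m \<Rightarrow>\<^sub>0 'f::field)" where
  "basis u \<equiv> Poly_Mapping.single u 1"

definition gen :: "'a \<Rightarrow> ('a fmon \<Rightarrow>\<^sub>0 'f::field)" where
  "gen a = basis (Word [a])"

definition lin_ext :: "('f::field \<Rightarrow> 'c::ab_group_add \<Rightarrow> 'c) \<Rightarrow> ('m \<Rightarrow> 'c) \<Rightarrow> ('m \<Rightarrow>\<^sub>0 'f) \<Rightarrow> 'c" where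
  "lin_ext s g p = (\<Sum>w\<in>Poly_Mapping.keys p. s (Poly_Mapping.lookup p w) (g w))"

definition free_lift ::
    "('f::field \<Rightarrow> 'b::ring_1 \<Rightarrow> 'b) \<Rightarrow> ('a \<Rightarrow> 'b) \<Rightarrow> ('a fmon \<Rightarrow>\<^sub>0 'f) \<Rightarrow> 'b" where
  "free_lift s f = lin_ext s (\<lambda>w. prod_list (map f (letters w)))"

definition free_antilift ::
    "('f::field \<Rightarrow> 'b::ring_1 \<Rightarrow> 'b) \<Rightarrow> ('a \<Rightarrow> 'b) \<Rightarrow> ('a fmon \<Rightarrow>\<^sub>0 'f) \<Rightarrow> 'b" where
  "free_antilift s f = lin_ext s (\<lambda>w. prod_list (map f (rev (letters w))))"

lemma lin_ext_superset:
  assumes "vector_space s" "finite K" "Poly_Mapping.keys p \<subseteq> K"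
  shows "lin_ext s g p = (\<Sum>w\<in>K. s (Poly_Mapping.lookup p w) (g w))"
proof -
  interpret vector_space s by fact
  show ?thesis
    unfolding lin_ext_def using assms
    by (intro sum.mono_neutral_left) (auto simp: in_keys_iff)
qed

lemma linear_lin_ext:
  assumes "vector_space s"
  shows "Vector_Spaces.linear pscale s (lin_ext s g)"
proof -
  interpret vector_space s by fact
  have "lin_ext s g (p + q) = lin_ext s g p + lin_ext s g q" for p q
    using keys_add[of p q]
    by (subst (1 2 3) lin_ext_superset[OF assms,
          where K = "Poly_Mapping.keys p \<union> Poly_Mapping.keys q"])
      (auto simp: lookup_add scale_left_distrib sum.distrib)
  moreover have "lin_ext s g (pscale c p) = s c (lin_ext s g p)" for c p
    by (subst (1 2) lin_ext_superset[OF assms, where K = "Poly_Mapping.keys p"])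
      (auto simp: scale_sum_right in_keys_iff)
  ultimately show ?thesis
    using assms vector_space_pscale
    by (simp add: module_hom_iff_linear[symmetric] module_hom_iff module_iff_vector_space)
qed

lemma lin_ext_basis [simp]: "vector_space s \<Longrightarrow> lin_ext s g (basis w) = g w"
  by (simp add: lin_ext_def vector_space.vector_space_assms(4))

lemma basis_expansion: "p = (\<Sum>w\<in>Poly_Mapping.keys p. pscale (Poly_Mapping.lookup p w) (basis w))"
  by (rule poly_mapping_eqI)
    (auto simp: lookup_sum lookup_single when_def in_keys_iff if_distrib cong: if_cong)

lemma linear_eqI:
  assumes "Vector_Spaces.linear pscale s \<phi>" "Vector_Spaces.linear pscale s \<psi>"
    and "\<And>w. \<phi> (basis w) = \<psi> (basis w)"
  shows "\<phi> = \<psi>"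
proof
  fix p
  interpret \<phi>: Vector_Spaces.linear pscale s \<phi> by fact
  interpret \<psi>: Vector_Spaces.linear pscale s \<psi> by fact
  show "\<phi> p = \<psi> p"
    by (subst (1 2) basis_expansion) (simp add: \<phi>.sum \<psi>.sum \<phi>.scale \<psi>.scale assms(3))
qed

lemma basis_Word_eq_prod: "(basis (Word as) :: _ \<Rightarrow>\<^sub>0 'f::field) = prod_list (map gen as)"
proof (induction as)
  case Nil
  then show ?case by (simp add: zero_fmon_def flip: single_one)
next
  case (Cons a as)
  have "(prod_list (map gen (a # as)) :: _ \<Rightarrow>\<^sub>0 'f) = gen a * basis (Word as)"
    by (simp only: Cons list.map prod_list.Cons)
  also have "\<dots> = basis (Word (a # as))"
    by (simp add: gen_def mult_single plus_fmon_def)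
  finally show ?case by simp
qed

locale scalar_alg = vector_space s for s :: "'f::field \<Rightarrow> 'b::ring_1 \<Rightarrow> 'b" +
  assumes mult_scale_left: "s c a * b = s c (a * b)"
    and mult_scale_right: "a * s c b = s c (a * b)"

lemma pscale_conv_mult: "pscale c p = Poly_Mapping.single 0 c * (p :: 'm::monoid_add \<Rightarrow>\<^sub>0 'f::field)"
  unfolding pscale_def by (rule mult_map_scale_conv_mult)

lemma pscale_single: "pscale c (Poly_Mapping.single u d) = Poly_Mapping.single u (c * d)"
  by (rule poly_mapping_eqI) (simp add: lookup_single when_def)

lemma scalar_alg_pscale: "scalar_alg (pscale :: 'f::field \<Rightarrow> ('m::monoid_add \<Rightarrow>\<^sub>0 'f) \<Rightarrow> _)"
proof -
  interpret vector_space "pscale :: 'f \<Rightarrow> ('m \<Rightarrow>\<^sub>0 'f) \<Rightarrow> _" by (rule vector_space_pscale)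
  have comm: "Poly_Mapping.single 0 c * p = p * Poly_Mapping.single 0 c"
    for c :: 'f and p :: "'m \<Rightarrow>\<^sub>0 'f"
    by (subst (1 2) basis_expansion[of p])
      (simp add: sum_distrib_left sum_distrib_right pscale_single mult_single mult.commute)
  show ?thesis
    by unfold_locales (simp_all only: pscale_conv_mult mult.assoc, metis comm mult.assoc)
qed

lemma scalar_alg_times: "scalar_alg ((*) :: 'f::field \<Rightarrow> _)"
  by unfold_locales (simp_all add: algebra_simps)

lemma lin_ext_mult:
  fixes p q :: "'m::monoid_add \<Rightarrow>\<^sub>0 'f::field"
  assumes "scalar_alg s" and "\<And>u v. g (u + v) = g u * g v"
  shows "lin_ext s g (p * q) = lin_ext s g p * lin_ext s g q"
proof -
  interpret s: scalar_alg s by fact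
  interpret P: scalar_alg "pscale :: 'f \<Rightarrow> ('m \<Rightarrow>\<^sub>0 'f) \<Rightarrow> _" by (rule scalar_alg_pscale)
  interpret L: Vector_Spaces.linear pscale s "lin_ext s g"
    by (rule linear_lin_ext) (rule s.vector_space_axioms)
  have "lin_ext s g (p * q) = lin_ext s g
      ((\<Sum>u\<in>Poly_Mapping.keys p. pscale (Poly_Mapping.lookup p u) (basis u)) *
       (\<Sum>v\<in>Poly_Mapping.keys q. pscale (Poly_Mapping.lookup q v) (basis v)))"
    by (simp flip: basis_expansion)
  also have "\<dots> = (\<Sum>u\<in>Poly_Mapping.keys p. \<Sum>v\<in>Poly_Mapping.keys q.
      s (Poly_Mapping.lookup p u) (s (Poly_Mapping.lookup q v) (g (u + v))))"
    by (simp add: sum_product L.sum L.scale P.mult_scale_left P.mult_scale_right mult_single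
        s.vector_space_axioms mult.commute)
  also have "\<dots> = lin_ext s g p * lin_ext s g q"
    by (simp add: lin_ext_def assms(2) sum_product s.mult_scale_left s.mult_scale_right
        mult.commute)
  finally show ?thesis .
qed

lemma lin_ext_antimult:
  fixes p q :: "'m::monoid_add \<Rightarrow>\<^sub>0 'f::field"
  assumes "scalar_alg s" and "\<And>u v. g (u + v) = g v * g u"
  shows "lin_ext s g (p * q) = lin_ext s g q * lin_ext s g p"
proof -
  interpret s: scalar_alg s by fact
  interpret P: scalar_alg "pscale :: 'f \<Rightarrow> ('m \<Rightarrow>\<^sub>0 'f) \<Rightarrow> _" by (rule scalar_alg_pscale)
  interpret L: Vector_Spaces.linear pscale s "lin_ext s g"
    by (rule linear_lin_ext) (rule s.vector_space_axioms)
  have "lin_ext s g (p * q) = lin_ext s g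
      ((\<Sum>u\<in>Poly_Mapping.keys p. pscale (Poly_Mapping.lookup p u) (basis u)) *
       (\<Sum>v\<in>Poly_Mapping.keys q. pscale (Poly_Mapping.lookup q v) (basis v)))"
    by (simp flip: basis_expansion)
  also have "\<dots> = (\<Sum>u\<in>Poly_Mapping.keys p. \<Sum>v\<in>Poly_Mapping.keys q.
      s (Poly_Mapping.lookup p u) (s (Poly_Mapping.lookup q v) (g (u + v))))"
    by (simp add: sum_product L.sum L.scale P.mult_scale_left P.mult_scale_right mult_single
        s.vector_space_axioms mult.commute)
  also have "\<dots> = (\<Sum>v\<in>Poly_Mapping.keys q. \<Sum>u\<in>Poly_Mapping.keys p.
      s (Poly_Mapping.lookup p u) (s (Poly_Mapping.lookup q v) (g (u + v))))"
    by (rule sum.swap)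
  also have "\<dots> = lin_ext s g q * lin_ext s g p"
    by (simp add: lin_ext_def assms(2) sum_product s.mult_scale_left s.mult_scale_right
        mult.commute)
  finally show ?thesis .
qed

lemma alg_hom_free_lift: "scalar_alg s \<Longrightarrow> alg_hom pscale s (free_lift s f)"
  unfolding alg_hom_def free_lift_def
  by (auto intro!: linear_lin_ext lin_ext_mult simp: scalar_alg.axioms plus_fmon_def
      simp flip: single_one)
    (simp add: zero_fmon_def scalar_alg.axioms)

lemma free_lift_gen [simp]: "scalar_alg s \<Longrightarrow> free_lift s f (gen a) = f a"
  by (simp add: free_lift_def gen_def scalar_alg.axioms)

lemma alg_hom_prod_list: "alg_hom s t \<phi> \<Longrightarrow> \<phi> (prod_list xs) = prod_list (map \<phi> xs)"
  by (induction xs) (auto simp: alg_hom_def)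

lemma alg_hom_eqI:
  assumes "alg_hom pscale s \<phi>" "alg_hom pscale s \<psi>" and "\<And>a. \<phi> (gen a) = \<psi> (gen a)"
  shows "\<phi> = \<psi>"
proof (rule linear_eqI)
  show "Vector_Spaces.linear pscale s \<phi>" "Vector_Spaces.linear pscale s \<psi>"
    using assms by (auto simp: alg_hom_def)
  show "\<phi> (basis w) = \<psi> (basis w)" for w
    using assms
    by (cases w) (simp add: basis_Word_eq_prod alg_hom_prod_list o_def)
qed

lemma free_lift_unique:
  assumes "scalar_alg s"
  shows "alg_hom pscale s \<phi> \<and> (\<forall>a. \<phi> (gen a) = f a) \<longleftrightarrow> \<phi> = free_lift s f"
  using assms by (auto intro: alg_hom_eqI alg_hom_free_lift)

lemma alg_antihom_free_antilift: "scalar_alg s \<Longrightarrow> alg_antihom pscale s (free_antilift s f)"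
  unfolding alg_antihom_def free_antilift_def
  by (auto intro!: linear_lin_ext lin_ext_antimult simp: scalar_alg.axioms plus_fmon_def
      simp flip: single_one)
    (simp add: zero_fmon_def scalar_alg.axioms)

lemma free_antilift_gen [simp]: "scalar_alg s \<Longrightarrow> free_antilift s f (gen a) = f a"
  by (simp add: free_antilift_def gen_def scalar_alg.axioms)

lemma alg_antihom_prod_list:
  "alg_antihom s t \<phi> \<Longrightarrow> \<phi> (prod_list xs) = prod_list (map \<phi> (rev xs))"
  by (induction xs) (auto simp: alg_antihom_def)

lemma free_antilift_unique:
  assumes "scalar_alg s"
  shows "alg_antihom pscale s \<phi> \<and> (\<forall>a. \<phi> (gen a) = f a) \<longleftrightarrow> \<phi> = free_antilift s f"
proof (intro iffI)
  assume *: "alg_antihom pscale s \<phi> \<and> (\<forall>a. \<phi> (gen a) = f a)"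
  have anti: "alg_antihom pscale s (free_antilift s f)"
    using assms by (rule alg_antihom_free_antilift)
  show "\<phi> = free_antilift s f"
  proof (rule linear_eqI)
    show "Vector_Spaces.linear pscale s \<phi>" "Vector_Spaces.linear pscale s (free_antilift s f)"
      using * anti by (auto simp: alg_antihom_def)
    show "\<phi> (basis w) = free_antilift s f (basis w)" for w
      using * anti assms
      by (cases w) (simp add: basis_Word_eq_prod alg_antihom_prod_list[of pscale s] rev_map o_def)
  qed
qed (use assms in \<open>auto intro: alg_antihom_free_antilift\<close>)


section \<open>Coproducts of free algebras\<close>

definition coprod_in1 :: "('a fmon \<Rightarrow>\<^sub>0 'f::field) \<Rightarrow> (('a + 'b) fmon \<Rightarrow>\<^sub>0 'f)" where
  "coprod_in1 = free_lift pscale (\<lambda>a. gen (Inl a))"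

definition coprod_in2 :: "('b fmon \<Rightarrow>\<^sub>0 'f::field) \<Rightarrow> (('a + 'b) fmon \<Rightarrow>\<^sub>0 'f)" where
  "coprod_in2 = free_lift pscale (\<lambda>b. gen (Inr b))"

definition coprod_lift ::
    "(('a fmon \<Rightarrow>\<^sub>0 'f) \<Rightarrow> ('m \<Rightarrow>\<^sub>0 'f)) \<Rightarrow> (('b fmon \<Rightarrow>\<^sub>0 'f) \<Rightarrow> ('m \<Rightarrow>\<^sub>0 'f)) \<Rightarrow>
     (('a + 'b) fmon \<Rightarrow>\<^sub>0 'f::field) \<Rightarrow> ('m::monoid_add \<Rightarrow>\<^sub>0 'f)" where
  "coprod_lift f g = free_lift pscale (case_sum (\<lambda>a. f (gen a)) (\<lambda>b. g (gen b)))"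

lemma coprod_lift_unique:
  fixes f :: "('a fmon \<Rightarrow>\<^sub>0 'f::field) \<Rightarrow> ('m::monoid_add \<Rightarrow>\<^sub>0 'f)"
    and g :: "('b fmon \<Rightarrow>\<^sub>0 'f) \<Rightarrow> ('m \<Rightarrow>\<^sub>0 'f)"
  assumes "alg_hom pscale pscale f" "alg_hom pscale pscale g"
  shows "alg_hom pscale pscale \<phi> \<and> \<phi> \<circ> coprod_in1 = f \<and> \<phi> \<circ> coprod_in2 = g \<longleftrightarrow>
    \<phi> = coprod_lift f g"
proof -
  have in1: "alg_hom pscale pscale coprod_in1" and in2: "alg_hom pscale pscale coprod_in2"
    by (simp_all add: coprod_in1_def coprod_in2_def alg_hom_free_lift scalar_alg_pscale)
  have comp: "alg_hom pscale pscale (\<phi> \<circ> \<psi>)"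
    if "alg_hom pscale pscale \<phi>" "alg_hom pscale pscale \<psi>"
    for \<phi> :: "('c::monoid_add \<Rightarrow>\<^sub>0 'f) \<Rightarrow> ('m::monoid_add \<Rightarrow>\<^sub>0 'f)"
      and \<psi> :: "('e::monoid_add \<Rightarrow>\<^sub>0 'f) \<Rightarrow> ('c \<Rightarrow>\<^sub>0 'f)"
    using that by (auto simp: alg_hom_def intro: Vector_Spaces.linear_compose)
  have lift: "alg_hom pscale pscale (coprod_lift f g)"
    by (simp add: coprod_lift_def alg_hom_free_lift scalar_alg_pscale)
  show ?thesis
  proof (intro iffI conjI)
    assume *: "alg_hom pscale pscale \<phi> \<and> \<phi> \<circ> coprod_in1 = f \<and> \<phi> \<circ> coprod_in2 = g"
    have "\<phi> (gen c) = case_sum (\<lambda>a. f (gen a)) (\<lambda>b. g (gen b)) c" for c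
      using *
      by (cases c) (auto simp: fun_eq_iff coprod_in1_def coprod_in2_def scalar_alg_pscale
          dest!: spec[of _ "gen _"])
    then show "\<phi> = coprod_lift f g"
      using * unfolding coprod_lift_def by (intro free_lift_unique[THEN iffD1] scalar_alg_pscale) auto
  next
    assume \<phi>: "\<phi> = coprod_lift f g"
    show "alg_hom pscale pscale \<phi>"
      by (simp add: \<phi> lift)
    show "\<phi> \<circ> coprod_in1 = f"
      by (rule alg_hom_eqI[OF comp[OF _ in1] assms(1)])
        (simp_all add: \<phi> lift, simp add: coprod_in1_def coprod_lift_def scalar_alg_pscale)
    show "\<phi> \<circ> coprod_in2 = g"
      by (rule alg_hom_eqI[OF comp[OF _ in2] assms(2)])
        (simp_all add: \<phi> lift, simp add: coprod_in2_def coprod_lift_def scalar_alg_pscale)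
  qed
qed

definition coprod_map ::
    "(('a fmon \<Rightarrow>\<^sub>0 'f) \<Rightarrow> ('c fmon \<Rightarrow>\<^sub>0 'f)) \<Rightarrow> (('b fmon \<Rightarrow>\<^sub>0 'f) \<Rightarrow> ('d fmon \<Rightarrow>\<^sub>0 'f)) \<Rightarrow>
     (('a + 'b) fmon \<Rightarrow>\<^sub>0 'f::field) \<Rightarrow> (('c + 'd) fmon \<Rightarrow>\<^sub>0 'f)" where
  "coprod_map f g = coprod_lift (\<lambda>p. coprod_in1 (f p)) (\<lambda>q. coprod_in2 (g q))"

definition folding :: "(('a + 'a) fmon \<Rightarrow>\<^sub>0 'f::field) \<Rightarrow> ('a fmon \<Rightarrow>\<^sub>0 'f)" where
  "folding = coprod_lift id id"

definition coloop_antipode ::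
    "(('a fmon \<Rightarrow>\<^sub>0 'f) \<Rightarrow> (('a + 'a) fmon \<Rightarrow>\<^sub>0 'f)) \<Rightarrow> (('a fmon \<Rightarrow>\<^sub>0 'f) \<Rightarrow> 'f::field) \<Rightarrow>
     (('a fmon \<Rightarrow>\<^sub>0 'f) \<Rightarrow> ('a fmon \<Rightarrow>\<^sub>0 'f)) \<Rightarrow> bool" where
  "coloop_antipode \<Delta> \<epsilon> S \<longleftrightarrow> alg_hom pscale pscale S \<and>
    (\<forall>h. folding (coprod_map S id (\<Delta> h)) = pscale (\<epsilon> h) 1) \<and>
    (\<forall>h. folding (coprod_map id S (\<Delta> h)) = pscale (\<epsilon> h) 1)"


section \<open>Tensor products and Hopf algebras\<close>

definition tensor :: "('m \<Rightarrow>\<^sub>0 'f::field) \<Rightarrow> ('n \<Rightarrow>\<^sub>0 'f) \<Rightarrow> ('m \<times> 'n \<Rightarrow>\<^sub>0 'f)" where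
  "tensor a b = (\<Sum>u\<in>Poly_Mapping.keys a. \<Sum>v\<in>Poly_Mapping.keys b.
     Poly_Mapping.single (u, v) (Poly_Mapping.lookup a u * Poly_Mapping.lookup b v))"

text \<open>The map induced by a bilinear map \<open>B\<close>, given by the values of \<open>B\<close> on the bases.\<close>

definition tensor_lift ::
    "('f::field \<Rightarrow> 'c::ab_group_add \<Rightarrow> 'c) \<Rightarrow> (('m \<Rightarrow>\<^sub>0 'f) \<Rightarrow> ('n \<Rightarrow>\<^sub>0 'f) \<Rightarrow> 'c) \<Rightarrow>
     ('m \<times> 'n \<Rightarrow>\<^sub>0 'f) \<Rightarrow> 'c" where
  "tensor_lift s B = lin_ext s (\<lambda>w. B (basis (fst w)) (basis (snd w)))"

definition bilinear_map ::
    "('f::field \<Rightarrow> 'c::ab_group_add \<Rightarrow> 'c) \<Rightarrow> (('m \<Rightarrow>\<^sub>0 'f) \<Rightarrow> ('n \<Rightarrow>\<^sub>0 'f) \<Rightarrow> 'c) \<Rightarrow> bool" where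
  "bilinear_map s B \<longleftrightarrow> (\<forall>b. Vector_Spaces.linear pscale s (\<lambda>a. B a b)) \<and>
    (\<forall>a. Vector_Spaces.linear pscale s (B a))"

lemma lookup_tensor:
  "Poly_Mapping.lookup (tensor a b) (u, v) = Poly_Mapping.lookup a u * Poly_Mapping.lookup b v"
proof -
  have "Poly_Mapping.lookup (tensor a b) (u, v) =
    (\<Sum>u'\<in>Poly_Mapping.keys a. if u' = u then Poly_Mapping.lookup a u' else 0) *
    (\<Sum>v'\<in>Poly_Mapping.keys b. if v' = v then Poly_Mapping.lookup b v' else 0)"
    unfolding tensor_def lookup_sum sum_product
    by (intro sum.cong refl) (simp add: lookup_single when_def)
  also have "\<dots> = Poly_Mapping.lookup a u * Poly_Mapping.lookup b v"
    by (simp add: in_keys_iff sum.delta)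
  finally show ?thesis .
qed

lemma bilinear_tensor: "bilinear_map pscale tensor"
  unfolding bilinear_map_def module_hom_iff_linear[symmetric] module_hom_iff
  by (auto intro!: poly_mapping_eqI
      simp: module_iff_vector_space vector_space_pscale lookup_tensor lookup_add algebra_simps)

lemma tensor_basis: "tensor (basis u) (basis v) = basis (u, v)"
  by (simp add: tensor_def)

lemma bilinear_eqI:
  assumes "bilinear_map s B" "bilinear_map s C"
    and "\<And>u v. B (basis u) (basis v) = C (basis u) (basis v)"
  shows "B a b = C a b"
proof -
  have "B (basis u) = C (basis u)" for u
    using assms by (intro linear_eqI[of s]) (auto simp: bilinear_map_def)
  then have "(\<lambda>a. B a b) = (\<lambda>a. C a b)"
    using assms by (intro linear_eqI[of s]) (auto simp: bilinear_map_def)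
  then show ?thesis by meson
qed

lemma tensor_mult:
  fixes a b :: "'m::monoid_add \<Rightarrow>\<^sub>0 'f::field" and c d :: "'n::monoid_add \<Rightarrow>\<^sub>0 'f"
  shows "tensor a c * tensor b d = tensor (a * b) (c * d)"
proof -
  interpret M: scalar_alg "pscale :: 'f \<Rightarrow> ('m \<Rightarrow>\<^sub>0 'f) \<Rightarrow> _" by (rule scalar_alg_pscale)
  interpret N: scalar_alg "pscale :: 'f \<Rightarrow> ('n \<Rightarrow>\<^sub>0 'f) \<Rightarrow> _" by (rule scalar_alg_pscale)
  interpret T: scalar_alg "pscale :: 'f \<Rightarrow> ('m \<times> 'n \<Rightarrow>\<^sub>0 'f) \<Rightarrow> _" by (rule scalar_alg_pscale)
  have add1: "tensor (x + y) z = tensor x z + tensor y z"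
    and add2: "tensor z' (x' + y') = tensor z' x' + tensor z' y'"
    and scale1: "tensor (pscale r x) z = pscale r (tensor x z)"
    and scale2: "tensor z' (pscale r x') = pscale r (tensor z' x')"
    for x y z' :: "'m \<Rightarrow>\<^sub>0 'f" and x' y' z :: "'n \<Rightarrow>\<^sub>0 'f" and r
    by (auto intro!: poly_mapping_eqI simp: lookup_tensor lookup_add algebra_simps)
  note linI = module_hom_iff_linear[symmetric] module_hom_iff module_iff_vector_space
    vector_space_pscale add1 add2 scale1 scale2 distrib_left distrib_right
    M.mult_scale_left N.mult_scale_left T.mult_scale_left
    M.mult_scale_right N.mult_scale_right T.mult_scale_right
  have *: "basis (u, v) * tensor b d = tensor (basis u * b) (basis v * d)" for u v
    by (rule bilinear_eqI[of pscale])
      (simp_all add: bilinear_map_def linI tensor_basis mult_single)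
  show ?thesis
    by (rule bilinear_eqI[of pscale, where a = a and b = c])
      (simp_all add: bilinear_map_def linI tensor_basis *)
qed

lemma tensor_lift_unique:
  fixes B :: "('m \<Rightarrow>\<^sub>0 'f::field) \<Rightarrow> ('n \<Rightarrow>\<^sub>0 'f) \<Rightarrow> 'c::ab_group_add"
  assumes "bilinear_map s B"
  shows "Vector_Spaces.linear pscale s \<phi> \<and> (\<forall>a b. \<phi> (tensor a b) = B a b) \<longleftrightarrow>
    \<phi> = tensor_lift s B"
proof -
  have s: "vector_space s"
    using assms by (auto simp: bilinear_map_def Vector_Spaces.linear_def)
  have lift: "Vector_Spaces.linear pscale s (tensor_lift s B)"
    unfolding tensor_lift_def using s by (rule linear_lin_ext)
  have comp: "bilinear_map s (\<lambda>a b. \<phi> (tensor a b))" if "Vector_Spaces.linear pscale s \<phi>"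
    for \<phi> :: "('m \<times> 'n \<Rightarrow>\<^sub>0 'f) \<Rightarrow> 'c"
    using bilinear_tensor that unfolding bilinear_map_def
    by (auto intro: Vector_Spaces.linear_compose[of pscale pscale _ s \<phi>, unfolded o_def])
  have "tensor_lift s B (tensor a b) = B a b" for a b
    by (rule bilinear_eqI[OF comp[OF lift] assms]) (simp add: tensor_basis tensor_lift_def s)
  moreover have "\<phi> = tensor_lift s B"
    if "Vector_Spaces.linear pscale s \<phi>" "\<forall>a b. \<phi> (tensor a b) = B a b"
  proof (rule linear_eqI[OF that(1) lift])
    show "\<phi> (basis w) = tensor_lift s B (basis w)" for w
      using that(2) by (cases w) (simp add: tensor_lift_def s flip: tensor_basis, simp add: tensor_basis s)
  qed
  ultimately show ?thesis using lift by blast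
qed

definition tensor_map ::
    "(('m \<Rightarrow>\<^sub>0 'f) \<Rightarrow> ('k \<Rightarrow>\<^sub>0 'f)) \<Rightarrow> (('n \<Rightarrow>\<^sub>0 'f) \<Rightarrow> ('l \<Rightarrow>\<^sub>0 'f)) \<Rightarrow>
     ('m \<times> 'n \<Rightarrow>\<^sub>0 'f::field) \<Rightarrow> ('k \<times> 'l \<Rightarrow>\<^sub>0 'f)" where
  "tensor_map f g = tensor_lift pscale (\<lambda>a b. tensor (f a) (g b))"

definition tensor_assoc ::
    "(('m \<times> 'n) \<times> 'k \<Rightarrow>\<^sub>0 'f::field) \<Rightarrow> ('m \<times> 'n \<times> 'k \<Rightarrow>\<^sub>0 'f)" where
  "tensor_assoc =
    tensor_lift pscale (\<lambda>ab c. tensor_lift pscale (\<lambda>a b. tensor a (tensor b c)) ab)"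

record (overloaded) ('m, 'f::zero) hopf_data =
  comult :: "('m \<Rightarrow>\<^sub>0 'f) \<Rightarrow> ('m \<times> 'm \<Rightarrow>\<^sub>0 'f)"
  counit :: "('m \<Rightarrow>\<^sub>0 'f) \<Rightarrow> 'f"
  antipode :: "('m \<Rightarrow>\<^sub>0 'f) \<Rightarrow> ('m \<Rightarrow>\<^sub>0 'f)"

text \<open>
  In the counit axioms \<open>\<bbbF> \<otimes> H\<close> and \<open>H \<otimes> \<bbbF>\<close> are identified with \<open>H\<close>.
\<close>

definition bialgebra ::
    "(('m::monoid_add \<Rightarrow>\<^sub>0 'f) \<Rightarrow> ('m \<times> 'm \<Rightarrow>\<^sub>0 'f)) \<Rightarrow> (('m \<Rightarrow>\<^sub>0 'f) \<Rightarrow> 'f::field) \<Rightarrow> bool" where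
  "bialgebra \<Delta> \<epsilon> \<longleftrightarrow>
    alg_hom pscale pscale \<Delta> \<and> alg_hom pscale (*) \<epsilon> \<and>
    (\<forall>h. tensor_assoc (tensor_map \<Delta> id (\<Delta> h)) = tensor_map id \<Delta> (\<Delta> h)) \<and>
    (\<forall>h. tensor_lift pscale (\<lambda>a b. pscale (\<epsilon> a) b) (\<Delta> h) = h) \<and>
    (\<forall>h. tensor_lift pscale (\<lambda>a b. pscale (\<epsilon> b) a) (\<Delta> h) = h)"

definition hopf_antipode ::
    "(('m::monoid_add \<Rightarrow>\<^sub>0 'f) \<Rightarrow> ('m \<times> 'm \<Rightarrow>\<^sub>0 'f)) \<Rightarrow> (('m \<Rightarrow>\<^sub>0 'f) \<Rightarrow> 'f::field) \<Rightarrow>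
     (('m \<Rightarrow>\<^sub>0 'f) \<Rightarrow> ('m \<Rightarrow>\<^sub>0 'f)) \<Rightarrow> bool" where
  "hopf_antipode \<Delta> \<epsilon> S \<longleftrightarrow> Vector_Spaces.linear pscale pscale S \<and>
    (\<forall>h. tensor_lift pscale (\<lambda>a b. S a * b) (\<Delta> h) = pscale (\<epsilon> h) 1) \<and>
    (\<forall>h. tensor_lift pscale (\<lambda>a b. a * S b) (\<Delta> h) = pscale (\<epsilon> h) 1)"

definition hopf_algebra :: "('m::monoid_add, 'f::field) hopf_data \<Rightarrow> bool" where
  "hopf_algebra A \<longleftrightarrow>
    bialgebra (comult A) (counit A) \<and> hopf_antipode (comult A) (counit A) (antipode A)"


section \<open>The Faa di Bruno coloop bialgebra\<close>

text \<open>
  The free algebra on the generators with index \<open>n \<ge> 1\<close>; the letter \<open>i\<close> stands for the generator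
  with index \<open>i + 1\<close>, and the generator with index \<open>0\<close> is the unit.
\<close>

type_synonym 'f fdb = "nat fmon \<Rightarrow>\<^sub>0 'f"

definition X :: "nat \<Rightarrow> 'f::field fdb" where
  "X n = (if n = 0 then 1 else gen (n - 1))"

definition fdb_hom :: "('f::field \<Rightarrow> 'b::ring_1 \<Rightarrow> 'b) \<Rightarrow> (nat \<Rightarrow> 'b) \<Rightarrow> 'f fdb \<Rightarrow> 'b" where
  "fdb_hom s f = free_lift s (\<lambda>i. f (i + 1))"

definition fdb_antihom :: "('f::field \<Rightarrow> 'b::ring_1 \<Rightarrow> 'b) \<Rightarrow> (nat \<Rightarrow> 'b) \<Rightarrow> 'f fdb \<Rightarrow> 'b" where
  "fdb_antihom s f = free_antilift s (\<lambda>i. f (i + 1))"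

definition compositions :: "nat \<Rightarrow> nat \<Rightarrow> nat list set" where
  "compositions n l = {ns. length ns = l \<and> sum_list ns = n \<and> (\<forall>k\<in>set ns. k \<ge> 1)}"

definition weak_compositions :: "nat \<Rightarrow> nat \<Rightarrow> nat list set" where
  "weak_compositions n l = {ks. length ks = l \<and> sum_list ks = n}"

lemma fdb_hom_X [simp]: "scalar_alg s \<Longrightarrow> n \<ge> 1 \<Longrightarrow> fdb_hom s f (X n) = f n"
  by (simp add: fdb_hom_def X_def)

lemma fdb_antihom_X [simp]: "scalar_alg s \<Longrightarrow> n \<ge> 1 \<Longrightarrow> fdb_antihom s f (X n) = f n"
  by (simp add: fdb_antihom_def X_def)

lemma finite_weak_compositions: "finite (weak_compositions n l)"
proof (rule finite_subset)
  show "weak_compositions n l \<subseteq> {ks. set ks \<subseteq> {..n} \<and> length ks = l}"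
    by (auto simp: weak_compositions_def member_le_sum_list)
  show "finite {ks. set ks \<subseteq> {..n} \<and> length ks = l}"
    by (rule finite_lists_length_eq) simp
qed

lemma finite_compositions: "finite (compositions n l)"
  by (rule finite_subset[OF _ finite_weak_compositions[of n l]])
    (auto simp: compositions_def weak_compositions_def)

definition fdb_counit :: "'f::field fdb \<Rightarrow> 'f" where
  "fdb_counit = fdb_hom (*) (\<lambda>n. 0)"

definition fdb_comult :: "'f::field fdb \<Rightarrow> ((nat + nat) fmon \<Rightarrow>\<^sub>0 'f)" where
  "fdb_comult = fdb_hom pscale (\<lambda>n. coprod_in1 (X n) + coprod_in2 (X n) +
     (\<Sum>l = 1..n - 1. \<Sum>ns\<in>compositions n (l + 1).
        of_nat ((hd ns + 1) choose l) *
          (coprod_in1 (X (hd ns)) * prod_list (map (\<lambda>k. coprod_in2 (X k)) (tl ns)))))"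

definition fdb_antipode :: "'f::field fdb \<Rightarrow> 'f fdb" where
  "fdb_antipode = (THE S. coloop_antipode fdb_comult fdb_counit S)"

definition canonical_proj :: "(('a + 'b) fmon \<Rightarrow>\<^sub>0 'f::field) \<Rightarrow> ('a fmon \<times> 'b fmon \<Rightarrow>\<^sub>0 'f)" where
  "canonical_proj = coprod_lift (\<lambda>h. tensor h 1) (\<lambda>h. tensor 1 h)"

text \<open>
  The antipode of a Hopf algebra reverses products, whereas that of a coloop bialgebra preserves
  them.  Hence the antipode of the image under the projection is the algebra
  anti-homomorphism with the same values on the generators.
\<close>

definition fdb_image :: "(nat fmon, 'f::field) hopf_data" where
  "fdb_image =
    \<lparr>comult = canonical_proj \<circ> fdb_comult,
     counit = fdb_counit,
     antipode = fdb_antihom pscale (\<lambda>n. fdb_antipode (X n))\<rparr>"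


section \<open>The non-commutative Faa di Bruno Hopf algebra\<close>

definition nc_comult :: "'f::field fdb \<Rightarrow> (nat fmon \<times> nat fmon \<Rightarrow>\<^sub>0 'f)" where
  "nc_comult = fdb_hom pscale (\<lambda>n. \<Sum>m = 0..n.
     tensor (X m) (\<Sum>ks\<in>weak_compositions (n - m) (m + 1). prod_list (map X ks)))"

definition fdb_nc :: "(nat fmon, 'f::field) hopf_data" where
  "fdb_nc =
    \<lparr>comult = nc_comult,
     counit = fdb_counit,
     antipode = (THE S. hopf_antipode nc_comult fdb_counit S)\<rparr>"

end

theory Submission
  imports Defs "HOL-Computational_Algebra.Formal_Power_Series"
begin

text \<open>
  Write the generators as one power series \<open>G = \<lambda> + x\<^sub>1 \<lambda>\<^sup>2 + x\<^sub>2 \<lambda>\<^sup>3 + \<dots>\<close>.  By the binomial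
  theorem both comultiplications say that \<open>\<Delta>\<close> maps \<open>G\<close> coefficientwise to the composition of its
  two copies, in the coproduct and in the tensor product respectively; so \<open>\<pi>\<close> carries one to the
  other.  Composition of series over a non-commutative ring is associative as soon as the inner
  composite commutes with the innermost series.  This gives coassociativity in the tensor product,
  where the coefficients of different factors commute.  It also makes the left compositional
  inverse of \<open>G\<close> a right inverse, since the inner composite is then the central variable
  \<open>\<lambda>\<close>; this is the antipode of the coloop bialgebra.  The anti-homomorphism with the same values
  on the generators satisfies the Hopf antipode identities on generators, hence everywhere, and a
  Hopf antipode is unique.
\<close>

section \<open>Composition of power series over a non-commutative ring\<close>

unbundle fps_syntax

text \<open>Powers \<open>c ^ i\<close> start at degree at least \<open>i\<close>, so raising the
  bound adds only zeros. A common bound for several coefficients is what allows sums to be exchanged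
  later.\<close>

lemma fps_compose_nth_ge:
  fixes f c :: "'a::ring_1 fps"
  assumes "c $ 0 = 0" "n \<le> N"
  shows "(f oo c) $ n = (\<Sum>i=0..N. f $ i * (c ^ i) $ n)"
  unfolding fps_compose_nth
  using assms by (intro sum.mono_neutral_left) (auto simp: startsby_zero_power_prefix)

lemma fps_compose_X_right: "f oo fps_X = (f :: 'a::ring_1 fps)"
  by (simp add: fps_eq_iff fps_compose_nth mult_delta_right)

lemma fps_X_compose_left: "c $ 0 = 0 \<Longrightarrow> fps_X oo c = (c :: 'a::ring_1 fps)"
  by (simp add: fps_eq_iff fps_compose_nth mult_delta_left not_le)

text \<open>In \<open>g oo c\<close> the coefficients of \<open>g\<close> stand to the left of the
  powers of \<open>c\<close>, so multiplying by \<open>c ^ i\<close> on the right merely raises each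
  exponent by \<open>i\<close>.\<close>

lemma fps_compose_mult_power_nth:
  fixes g c :: "'a::ring_1 fps"
  assumes c: "c $ 0 = 0" and "n \<le> N"
  shows "((g oo c) * c ^ i) $ n = (\<Sum>j=0..N. g $ j * (c ^ (i + j)) $ n)"
proof -
  have "((g oo c) * c ^ i) $ n = (\<Sum>k=0..n. (\<Sum>j=0..N. g $ j * (c ^ j) $ k) * (c ^ i) $ (n - k))"
    unfolding fps_mult_nth using assms
    by (intro sum.cong refl) (simp add: fps_compose_nth_ge[OF c, of _ N])
  also have "\<dots> = (\<Sum>j=0..N. g $ j * (\<Sum>k=0..n. (c ^ j) $ k * (c ^ i) $ (n - k)))"
    by (simp add: sum_distrib_left sum_distrib_right mult.assoc) (rule sum.swap)
  also have "\<dots> = (\<Sum>j=0..N. g $ j * (c ^ (i + j)) $ n)"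
    by (simp add: add.commute[of i] power_add fps_mult_nth)
  finally show ?thesis .
qed

text \<open>The left side is built from \<open>f $ i * g $ j * c ^ (i + j)\<close>, whereas the
  right side has \<open>c ^ i\<close> between the two coefficients. The hypothesis moves
  \<open>c ^ i\<close> past the whole series \<open>g oo c\<close>; single coefficients of
  \<open>g\<close> may fail to commute with \<open>c\<close>.\<close>

lemma fps_compose_mult:
  fixes f g c :: "'a::ring_1 fps"
  assumes c: "c $ 0 = 0" and comm: "(g oo c) * c = c * (g oo c)"
  shows "(f * g) oo c = (f oo c) * (g oo c)"
proof (rule fps_ext)
  fix n
  have commp: "(g oo c) * c ^ i = c ^ i * (g oo c)" for i
    using power_commuting_commutes[OF comm[symmetric], of i] by simp
  have zero: "i + j \<le> n" if "(c ^ (i + j)) $ n \<noteq> 0" for i j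
    using that startsby_zero_power_prefix[OF c] by (meson not_le)
  have "((f * g) oo c) $ n = (\<Sum>k=0..n. \<Sum>i=0..k. f $ i * g $ (k - i) * (c ^ k) $ n)"
    by (simp add: fps_compose_nth fps_mult_nth sum_distrib_right)
  also have "\<dots> = (\<Sum>(k,i)\<in>(SIGMA k:{0..n}. {0..k}). f $ i * g $ (k - i) * (c ^ k) $ n)"
    by (simp add: sum.Sigma)
  also have "\<dots> = (\<Sum>(i,j)\<in>{(i,j). i \<in> {0..n} \<and> j \<in> {0..n} \<and> i + j \<le> n}. f $ i * g $ j * (c ^ (i + j)) $ n)"
    by (rule sum.reindex_bij_witness[where i = "\<lambda>(i,j). (i + j, i)" and j = "\<lambda>(k,i). (i, k - i)"]) auto
  \<comment> \<open>The triangle is filled up to a square; the new terms vanish because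
    \<open>c ^ (i + j)\<close> starts beyond degree \<open>n\<close>.\<close>
  also have "\<dots> = (\<Sum>(i,j)\<in>{0..n} \<times> {0..n}. f $ i * g $ j * (c ^ (i + j)) $ n)"
    by (rule sum.mono_neutral_left) (auto intro!: zero)
  also have "\<dots> = (\<Sum>i=0..n. f $ i * (\<Sum>j=0..n. g $ j * (c ^ (i + j)) $ n))"
    by (simp add: sum.cartesian_product[symmetric] sum_distrib_left mult.assoc)
  \<comment> \<open>Here commutation enters: the inner sum is a coefficient of
    \<open>(g oo c) * c ^ i\<close>, and the power is moved to the front.\<close>
  also have "\<dots> = (\<Sum>i=0..n. f $ i * (c ^ i * (g oo c)) $ n)"
    using fps_compose_mult_power_nth[OF c order.refl, of g] commp by simp
  also have "\<dots> = (\<Sum>i=0..n. f $ i * (\<Sum>k=0..n. (c ^ i) $ k * (g oo c) $ (n - k)))"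
    by (simp add: fps_mult_nth)
  also have "\<dots> = (\<Sum>k=0..n. (\<Sum>i=0..n. f $ i * (c ^ i) $ k) * (g oo c) $ (n - k))"
    by (simp add: sum_distrib_left sum_distrib_right mult.assoc) (rule sum.swap)
  also have "\<dots> = ((f oo c) * (g oo c)) $ n"
    unfolding fps_mult_nth
    by (intro sum.cong refl) (simp add: fps_compose_nth_ge[OF c, of _ n])
  finally show "((f * g) oo c) $ n = ((f oo c) * (g oo c)) $ n" .
qed

text \<open>\<open>fps_compose_mult\<close> turns \<open>(b ^ i) oo c\<close> into
  \<open>(b oo c) ^ i\<close>. The coefficients of \<open>f\<close> stay leftmost throughout, so
  this is enough.\<close>

lemma fps_compose_assoc_commuting:
  fixes f b c :: "'a::ring_1 fps"
  assumes b: "b $ 0 = 0" and c: "c $ 0 = 0" and comm: "(b oo c) * c = c * (b oo c)"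
  shows "(f oo b) oo c = f oo (b oo c)"
proof (rule fps_ext)
  fix n
  have pow: "(b ^ i) oo c = (b oo c) ^ i" for i
  proof (induction i)
    case (Suc i)
    then show ?case
      using fps_compose_mult[OF c comm, of "b ^ i"] by (simp add: power_commutes)
  qed simp
  have bc: "(b oo c) $ 0 = 0"
    using b by simp
  have "((f oo b) oo c) $ n = (\<Sum>k=0..n. (\<Sum>i=0..n. f $ i * (b ^ i) $ k) * (c ^ k) $ n)"
    unfolding fps_compose_nth[of "f oo b"] using fps_compose_nth_ge[OF b, of _ n]
    by (intro sum.cong refl) simp
  also have "\<dots> = (\<Sum>i=0..n. f $ i * (\<Sum>k=0..n. (b ^ i) $ k * (c ^ k) $ n))"
    by (simp add: sum_distrib_left sum_distrib_right mult.assoc) (rule sum.swap)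
  also have "\<dots> = (f oo (b oo c)) $ n"
    by (simp add: fps_compose_nth[of f] flip: pow) (simp add: fps_compose_nth)
  finally show "((f oo b) oo c) $ n = (f oo (b oo c)) $ n" .
qed

text \<open>Each coefficient of \<open>c\<close> passes every \<open>b $ j\<close>, and
  \<open>c\<close> commutes with its own powers. The coefficients of \<open>c\<close> may still fail
  to commute with each other, as the generators inside one tensor factor do.\<close>

lemma fps_compose_commutes:
  fixes b c :: "'a::ring_1 fps"
  assumes c: "c $ 0 = 0" and comm: "\<And>i j. b $ i * c $ j = c $ j * b $ i"
  shows "(b oo c) * c = c * (b oo c)"
proof (rule fps_ext)
  fix n
  have "((b oo c) * c) $ n = (\<Sum>j=0..n. b $ j * (c ^ Suc j) $ n)"
    using fps_compose_mult_power_nth[OF c order.refl, of b 1] by simp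
  also have "\<dots> = (\<Sum>j=0..n. \<Sum>k=0..n. c $ k * (b $ j * (c ^ j) $ (n - k)))"
    by (simp add: fps_mult_nth sum_distrib_left comm flip: mult.assoc)
  also have "\<dots> = (\<Sum>k=0..n. c $ k * (\<Sum>j=0..n. b $ j * (c ^ j) $ (n - k)))"
    by (simp add: sum_distrib_left) (rule sum.swap)
  also have "\<dots> = (c * (b oo c)) $ n"
    unfolding fps_mult_nth
    by (intro sum.cong refl) (simp add: fps_compose_nth_ge[OF c, of _ n])
  finally show "((b oo c) * c) $ n = (c * (b oo c)) $ n" .
qed

section \<open>Compositional inverses\<close>

lemma fps_compose_left_cancel:
  fixes f g b :: "'a::ring_1 fps"
  assumes b: "b $ 0 = 0" "b $ 1 = 1" and eq: "f oo b = g oo b"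
  shows "f = g"
proof (rule fps_ext)
  have pow_same: "(b ^ k) $ k = 1" for k
    using b by (simp add: startsby_zero_power_nth_same)
  show "f $ n = g $ n" for n
  proof (induction n rule: less_induct)
    case (less n)
    \<comment> \<open>The equations are triangular with unit diagonal: coefficient \<open>n\<close>
      of \<open>h oo b\<close> contains \<open>h $ n\<close> with factor 1 and otherwise only
      earlier coefficients of \<open>h\<close>.\<close>
    have split: "(h oo b) $ n = (\<Sum>i<n. h $ i * (b ^ i) $ n) + h $ n" for h
      by (cases n) (simp_all add: fps_compose_nth pow_same atLeast0AtMost
          lessThan_Suc_atMost del: power_Suc)
    have "(\<Sum>i<n. f $ i * (b ^ i) $ n) = (\<Sum>i<n. g $ i * (b ^ i) $ n)"
      using less by simp
    then show ?case
      using split[of f] split[of g] eq by simp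
  qed
qed

text \<open>This is coefficient \<open>Suc n\<close> of \<open>s oo b = fps_X\<close> solved for
  \<open>s $ Suc n\<close>, whose factor \<open>(b ^ Suc n) $ Suc n\<close> equals 1 when
  \<open>b $ 0 = 0\<close> and \<open>b $ 1 = 1\<close>.\<close>

fun left_compinv :: "'a::ring_1 fps \<Rightarrow> nat \<Rightarrow> 'a" where
  "left_compinv b 0 = 0"
| "left_compinv b (Suc n) = fps_X $ Suc n - (\<Sum>i=0..n. left_compinv b i * (b ^ i) $ Suc n)"

lemma left_compinv:
  fixes b :: "'a::ring_1 fps"
  assumes b: "b $ 0 = 0" "b $ 1 = 1"
  shows "Abs_fps (left_compinv b) oo b = fps_X"
proof (rule fps_ext)
  have pow_same: "(b ^ k) $ k = 1" for k
    using b by (simp add: startsby_zero_power_nth_same)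
  show "(Abs_fps (left_compinv b) oo b) $ n = fps_X $ n" for n
    by (cases n) (simp_all add: fps_compose_nth pow_same del: power_Suc)
qed

text \<open>Centrality of \<open>fps_X\<close> permits rebracketing \<open>(b oo s) oo b\<close>,
  which is therefore \<open>b\<close>; cancelling \<open>b\<close> on the right leaves
  \<open>fps_X\<close>.\<close>

lemma left_inverse_imp_right_inverse:
  fixes s b :: "'a::ring_1 fps"
  assumes b: "b $ 0 = 0" "b $ 1 = 1" and s: "s $ 0 = 0" and sb: "s oo b = fps_X"
  shows "b oo s = fps_X"
proof -
  have comm: "(s oo b) * b = b * (s oo b)"
    by (simp add: sb fps_mult_fps_X_commute)
  have "(b oo s) oo b = b oo (s oo b)"
    by (rule fps_compose_assoc_commuting[OF s b(1) comm])
  also have "\<dots> = fps_X oo b"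
    using b by (simp add: sb fps_compose_X_right fps_X_compose_left)
  finally show ?thesis
    by (rule fps_compose_left_cancel[OF b])
qed

section \<open>Composition in terms of coefficient sequences\<close>

lemma weak_compositions_0: "weak_compositions n 0 = (if n = 0 then {[]} else {})"
  by (auto simp: weak_compositions_def)

lemma weak_compositions_1: "weak_compositions n (Suc 0) = {[n]}"
  by (auto simp: weak_compositions_def length_Suc_conv)

lemma sum_weak_compositions_Suc:
  "(\<Sum>ks\<in>weak_compositions n (Suc l). f ks) = (\<Sum>k=0..n. \<Sum>ks\<in>weak_compositions (n - k) l. f (k # ks))"
  unfolding sum.Sigma[OF finite_atLeastAtMost ballI[OF finite_weak_compositions]]
  by (rule sum.reindex_bij_witness[where i = "\<lambda>(k, ks). k # ks" and j = "\<lambda>ks. (hd ks, tl ks)"])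
    (auto simp: weak_compositions_def length_Suc_conv)

lemma sum_compositions_Suc:
  "(\<Sum>ks\<in>compositions n (Suc l). f ks) = (\<Sum>k=1..n. \<Sum>ks\<in>compositions (n - k) l. f (k # ks))"
  unfolding sum.Sigma[OF finite_atLeastAtMost ballI[OF finite_compositions]]
  by (rule sum.reindex_bij_witness[where i = "\<lambda>(k, ks). k # ks" and j = "\<lambda>ks. (hd ks, tl ks)"])
    (auto simp: compositions_def length_Suc_conv)

lemma nth_Abs_fps: "($) (Abs_fps b) = b"
  by (simp add: fun_eq_iff)

lemma fps_power_nth_weak_compositions:
  fixes F :: "'a::ring_1 fps"
  shows "(F ^ l) $ n = (\<Sum>ks\<in>weak_compositions n l. prod_list (map (($) F) ks))"
proof (induction l arbitrary: n)
  case 0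
  then show ?case by (simp add: weak_compositions_0)
next
  case (Suc l)
  show ?case
    by (simp add: fps_mult_nth Suc sum_weak_compositions_Suc sum_distrib_left)
qed

lemma prod_list_eq_0:
  fixes xs :: "'a::ring_1 list"
  shows "0 \<in> set xs \<Longrightarrow> prod_list xs = 0"
  by (induction xs) auto

text \<open>The summands 1 and \<open>F\<close> commute, so the binomial theorem survives in a
  non-commutative ring. The induction is Pascal's rule.\<close>

lemma fps_one_plus_power:
  fixes F :: "'a::ring_1 fps"
  shows "((1 + F) ^ k) $ n = (\<Sum>l=0..k. of_nat (k choose l) * (F ^ l) $ n)"
proof (induction k arbitrary: n)
  case (Suc k)
  have mult: "((\<Sum>l=0..k. of_nat (k choose l) * F ^ l)) $ n = ((1 + F) ^ k) $ n" for n
    by (simp add: Suc fps_sum_nth fps_mult_of_nat_nth)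
  have "(1 + F) ^ k = (\<Sum>l=0..k. of_nat (k choose l) * F ^ l)"
    by (rule fps_ext) (simp add: mult)
  then have "(1 + F) ^ Suc k = (\<Sum>l=0..k. of_nat (k choose l) * F ^ l) * (1 + F)"
    by (simp add: power_Suc2 del: power_Suc)
  also have "\<dots> = (\<Sum>l=0..k. of_nat (k choose l) * F ^ l) + (\<Sum>l=0..k. of_nat (k choose l) * F ^ Suc l)"
    by (simp add: distrib_left sum_distrib_right power_commutes mult.assoc)
  also have "(\<Sum>l=0..k. of_nat (k choose l) * F ^ Suc l) = (\<Sum>l=1..Suc k. of_nat (k choose (l - 1)) * F ^ l)"
    by (rule sum.reindex_bij_witness[where i = "\<lambda>l. l - 1" and j = Suc]) auto
  \<comment> \<open>A zero coefficient at \<open>l = 0\<close> gives both sums the same range, so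
    that Pascal's rule applies termwise.\<close>
  also have "\<dots> = (\<Sum>l=0..Suc k. (if l = 0 then 0 else of_nat (k choose (l - 1))) * F ^ l)"
    by (intro sum.mono_neutral_cong_left) auto
  also have "(\<Sum>l=0..k. of_nat (k choose l) * F ^ l) = (\<Sum>l=0..Suc k. of_nat (k choose l) * F ^ l)"
    by (simp add: binomial_eq_0)
  also have "(\<Sum>l=0..Suc k. of_nat (k choose l) * F ^ l) +
      (\<Sum>l=0..Suc k. (if l = 0 then 0 else of_nat (k choose (l - 1))) * F ^ l) =
      (\<Sum>l=0..Suc k. of_nat (Suc k choose l) * F ^ l)"
    unfolding sum.distrib[symmetric] distrib_right[symmetric]
    by (intro sum.cong refl) (auto simp: gr0_conv_Suc add.commute)
  finally show ?case
    by (simp add: fps_sum_nth fps_mult_of_nat_nth del: power_Suc)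
qed simp

text \<open>The binomial coefficient counts the possible places of the positive entries; each zero
  entry contributes \<open>b 0 = 1\<close>. This links the weak compositions in
  \<open>nc_comult\<close> to the binomials in \<open>fdb_comult\<close>.\<close>

lemma sum_weak_compositions:
  fixes b :: "nat \<Rightarrow> 'a::ring_1"
  assumes "b 0 = 1"
  shows "(\<Sum>ks\<in>weak_compositions n k. prod_list (map b ks)) =
    (\<Sum>l=0..k. of_nat (k choose l) * (\<Sum>ks\<in>compositions n l. prod_list (map b ks)))"
proof -
  \<comment> \<open>This series has no constant term, so only compositions into positive parts
    contribute to \<open>F ^ l\<close>; expanding the power of \<open>1 + F\<close> does the
    counting.\<close>
  define F where "F = Abs_fps b - 1"
  have "(F ^ l) $ n = (\<Sum>ks\<in>compositions n l. prod_list (map b ks))" for l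
    unfolding fps_power_nth_weak_compositions
  proof (rule sum.mono_neutral_cong_right)
    show "\<forall>ks\<in>weak_compositions n l - compositions n l. prod_list (map (($) F) ks) = 0"
    proof
      fix ks assume "ks \<in> weak_compositions n l - compositions n l"
      then have "0 \<in> set ks"
        by (auto simp: weak_compositions_def compositions_def Suc_le_eq)
      moreover have "F $ 0 = 0"
        by (simp add: F_def assms)
      ultimately show "prod_list (map (($) F) ks) = 0"
        by (intro prod_list_eq_0) (force simp: image_iff)
    qed
    show "prod_list (map (($) F) ks) = prod_list (map b ks)" if "ks \<in> compositions n l" for ks
      using that by (intro arg_cong[of _ _ prod_list] map_cong) (auto simp: F_def compositions_def)
  qed (rule finite_weak_compositions, auto simp: weak_compositions_def compositions_def)
  moreover have "(\<Sum>ks\<in>weak_compositions n k. prod_list (map b ks)) = ((1 + F) ^ k) $ n"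
    by (simp add: F_def fps_power_nth_weak_compositions nth_Abs_fps)
  ultimately show ?thesis
    by (simp add: fps_one_plus_power)
qed

text \<open>
  Coefficient sequences are shifted by one: \<open>a\<close> stands for the formal diffeomorphism
  \<open>\<lambda> + a\<^sub>1 \<lambda>\<^sup>2 + a\<^sub>2 \<lambda>\<^sup>3 + \<dots>\<close> when \<open>a 0 = 1\<close>.
\<close>

definition ser :: "(nat \<Rightarrow> 'a::ring_1) \<Rightarrow> 'a fps" where
  "ser a = fps_X * Abs_fps a"

lemma ser_nth: "ser a $ n = (if n = 0 then 0 else a (n - 1))"
  by (simp add: ser_def)

text \<open>Since \<open>fps_X\<close> is central, \<open>ser b ^ (m + 1)\<close> splits off
  \<open>fps_X ^ (m + 1)\<close>, and coefficient \<open>Suc n\<close> becomes coefficient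
  \<open>n - m\<close>. The result has the shape of the formula defining
  \<open>nc_comult\<close>.\<close>

lemma ser_compose_nth:
  fixes a b :: "nat \<Rightarrow> 'a::ring_1"
  shows "(ser a oo ser b) $ Suc n =
    (\<Sum>m=0..n. a m * (\<Sum>ks\<in>weak_compositions (n - m) (m + 1). prod_list (map b ks)))"
proof -
  have pow: "ser b ^ k = fps_X ^ k * Abs_fps b ^ k" for k
  proof (induction k)
    case (Suc k)
    have "ser b ^ Suc k = ser b * (fps_X ^ k * Abs_fps b ^ k)"
      by (simp only: power_Suc Suc)
    also have "\<dots> = fps_X * (Abs_fps b * fps_X ^ k) * Abs_fps b ^ k"
      by (simp add: ser_def mult.assoc)
    also have "\<dots> = fps_X ^ Suc k * Abs_fps b ^ Suc k"
      by (simp only: fps_mult_fps_X_power_commute[of k "Abs_fps b", symmetric] power_Suc mult.assoc)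
    finally show ?case .
  qed simp
  have "(ser a oo ser b) $ Suc n = (\<Sum>i=0..Suc n. ser a $ i * (ser b ^ i) $ Suc n)"
    by (simp only: fps_compose_nth)
  also have "\<dots> = (\<Sum>m=0..n. ser a $ Suc m * (ser b ^ Suc m) $ Suc n)"
    by (subst sum.atLeast0_atMost_Suc_shift) (simp add: ser_nth)
  also have "\<dots> = (\<Sum>m=0..n. a m * (Abs_fps b ^ Suc m) $ (n - m))"
    by (intro sum.cong refl) (simp add: ser_nth pow fps_X_power_mult_nth del: power_Suc)
  finally show ?thesis
    by (simp add: fps_power_nth_weak_compositions nth_Abs_fps del: power_Suc)
qed

text \<open>Sorting weak compositions by their number of positive entries turns the formula of
  \<open>ser_compose_nth\<close> into the one defining \<open>fdb_comult\<close>.\<close>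

lemma ser_compose_nth_compositions:
  fixes a b :: "nat \<Rightarrow> 'a::ring_1"
  assumes ab: "a 0 = 1" "b 0 = 1" and n: "n \<ge> 1"
  shows "(ser a oo ser b) $ Suc n = a n + b n +
    (\<Sum>l=1..n - 1. \<Sum>ns\<in>compositions n (l + 1).
       of_nat ((hd ns + 1) choose l) * (a (hd ns) * prod_list (map b (tl ns))))"
proof -
  define P where "P N l = (\<Sum>ks\<in>compositions N l. prod_list (map b ks))" for N l
  have comp_empty: "compositions N l = {}" if "N < l" for N l
  proof -
    have "length ks \<le> sum_list ks" if "\<forall>k\<in>set ks. k \<ge> 1" for ks :: "nat list"
      using that by (induction ks) auto
    then show ?thesis
      using \<open>N < l\<close> by (force simp: compositions_def)
  qed
  have P_big: "P N l = 0" if "N < l" for N l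
    by (simp add: P_def comp_empty that)
  have comp_0: "compositions N 0 = (if N = 0 then {[]} else {})" for N
    by (auto simp: compositions_def)
  have P_0: "P N 0 = (if N = 0 then 1 else 0)" for N
    by (simp add: P_def comp_0)
  have "compositions n 1 = {[n]}"
    using n by (auto simp: compositions_def length_Suc_conv)
  then have P_1: "P n 1 = b n"
    by (simp add: P_def)
  define Q where "Q m = a m * (\<Sum>l=0..m + 1. of_nat ((m + 1) choose l) * P (n - m) l)" for m
  have "(ser a oo ser b) $ Suc n = (\<Sum>m=0..n. Q m)"
    by (simp only: ser_compose_nth sum_weak_compositions[of b, OF ab(2)] P_def Q_def)
  \<comment> \<open>The terms \<open>m = n\<close> and \<open>m = 0\<close>, distinct because
    \<open>n \<ge> 1\<close>, yield the linear terms \<open>a n\<close> and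
    \<open>b n\<close>.\<close>
  also have "{0..n} = insert 0 (insert n {1..n - 1})"
    using n by auto
  also have "sum Q \<dots> = Q n + Q 0 + sum Q {1..n - 1}"
    using n by (simp add: add_ac)
  also have "Q n = a n"
    by (simp add: Q_def sum.atLeast_Suc_atMost[of 0] P_0 P_big)
  also have "Q 0 = b n"
    using n P_1 by (simp add: Q_def P_0 ab)
  \<comment> \<open>The range of \<open>l\<close> is made independent of \<open>m\<close>, so that
    the sums can be swapped: the binomial vanishes beyond \<open>m + 1\<close>, and
    \<open>P (n - m) l\<close> vanishes for \<open>l = 0\<close> and for
    \<open>l \<ge> n\<close>.\<close>
  also have "sum Q {1..n - 1} =
      (\<Sum>m=1..n - 1. \<Sum>l=1..n - 1. a m * (of_nat ((m + 1) choose l) * P (n - m) l))"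
    unfolding Q_def sum_distrib_left
  proof (intro sum.cong[OF refl] sum.mono_neutral_cong)
    fix m l assume m: "m \<in> {1..n - 1}"
    show "a m * (of_nat ((m + 1) choose l) * P (n - m) l) = 0" if "l \<in> {1..n - 1} - {0..m + 1}"
      using that by (simp add: binomial_eq_0 del: binomial_Suc_Suc)
    show "a m * (of_nat ((m + 1) choose l) * P (n - m) l) = 0" if "l \<in> {0..m + 1} - {1..n - 1}"
      using that m by (cases "l = 0") (auto simp: P_0 P_big)
  qed auto
  also have "\<dots> = (\<Sum>l=1..n - 1. \<Sum>m=1..n - 1. a m * (of_nat ((m + 1) choose l) * P (n - m) l))"
    by (rule sum.swap)
  also have "\<dots> = (\<Sum>l=1..n - 1. \<Sum>ns\<in>compositions n (l + 1).
       of_nat ((hd ns + 1) choose l) * (a (hd ns) * prod_list (map b (tl ns))))"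
  proof (intro sum.cong refl)
    fix l assume l: "l \<in> {1..n - 1}"
    have comm: "of_nat j * (x * y) = x * (of_nat j * y)" for j and x y :: 'a
      by (metis mult.assoc mult_of_nat_commute)
    have "(\<Sum>ns\<in>compositions n (l + 1).
        of_nat ((hd ns + 1) choose l) * (a (hd ns) * prod_list (map b (tl ns)))) =
      (\<Sum>m=1..n. \<Sum>ks\<in>compositions (n - m) l.
        of_nat ((m + 1) choose l) * (a m * prod_list (map b ks)))"
      by (simp add: sum_compositions_Suc del: binomial_Suc_Suc)
    also have "\<dots> = (\<Sum>m=1..n. a m * (of_nat ((m + 1) choose l) * P (n - m) l))"
      by (simp only: P_def sum_distrib_left comm)
    \<comment> \<open>For \<open>m = n\<close> nothing is left to be split into
      \<open>l \<ge> 1\<close> positive parts.\<close>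
    also have "\<dots> = (\<Sum>m=1..n - 1. a m * (of_nat ((m + 1) choose l) * P (n - m) l))"
      using l by (intro sum.mono_neutral_right) (auto simp: P_big not_le)
    finally show "(\<Sum>m=1..n - 1. a m * (of_nat ((m + 1) choose l) * P (n - m) l)) =
      (\<Sum>ns\<in>compositions n (l + 1).
        of_nat ((hd ns + 1) choose l) * (a (hd ns) * prod_list (map b (tl ns))))" ..
  qed
  finally show ?thesis .
qed

section \<open>Linear maps and algebra homomorphisms\<close>

lemma linear_pscaleI:
  assumes "\<And>x y. f (x + y) = f x + f y" "\<And>c x. f (pscale c x) = pscale c (f x)"
  shows "Vector_Spaces.linear pscale pscale f"
  using assms by (simp add: module_hom_iff_linear[symmetric] module_hom_iff
      module_iff_vector_space vector_space_pscale)

lemma linear_pscaleD: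
  assumes "Vector_Spaces.linear s t f"
  shows "f (x + y) = f x + f y" "f (s c x) = t c (f x)"
  using assms by (simp_all add: module_hom_iff_linear[symmetric] module_hom_iff)

lemma tensor_add_left: "tensor (x + y) z = tensor x z + tensor y z"
  and tensor_add_right: "tensor z' (x' + y') = tensor z' x' + tensor z' y'"
  and tensor_pscale_left: "tensor (pscale r x) z = pscale r (tensor x z)"
  and tensor_pscale_right: "tensor z' (pscale r x') = pscale r (tensor z' x')"
  by (auto intro!: poly_mapping_eqI simp: lookup_tensor lookup_add algebra_simps)

lemma pscale_mult_left: "pscale c a * b = pscale c (a * b)"
  and pscale_mult_right: "a * pscale c b = pscale c (a * b)"
  for a b :: "'m::monoid_add \<Rightarrow>\<^sub>0 'f::field"
  using scalar_alg_pscale scalar_alg.mult_scale_left scalar_alg.mult_scale_right by blast+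

lemma pscale_add: "pscale c (a + b) = pscale c a + pscale c b"
  and pscale_add_left: "pscale (c + d) a = pscale c a + pscale d a"
  and pscale_pscale: "pscale c (pscale d a) = pscale (c * d) a"
  and pscale_one: "pscale 1 a = a"
  by (auto intro!: poly_mapping_eqI simp: lookup_add algebra_simps)

lemmas lin_simps = tensor_add_left tensor_add_right tensor_pscale_left tensor_pscale_right
  pscale_mult_left pscale_mult_right pscale_add pscale_add_left pscale_pscale pscale_one
  distrib_left distrib_right

lemma linear_tensor_lift [simp, intro]:
  "Vector_Spaces.linear pscale pscale (tensor_lift pscale B)"
  unfolding tensor_lift_def by (rule linear_lin_ext) (rule vector_space_pscale)

lemma tensor_lift_basis [simp]:
  "tensor_lift pscale B (basis (u, v)) = B (basis u) (basis v)"
  by (simp add: tensor_lift_def vector_space_pscale)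

lemma tensor_lift_tensor:
  assumes "bilinear_map s B"
  shows "tensor_lift s B (tensor a b) = B a b"
  using tensor_lift_unique[OF assms, of "tensor_lift s B"] by blast

lemma linear_eqI':
  assumes "Vector_Spaces.linear pscale s \<phi>" "Vector_Spaces.linear pscale s \<psi>"
    and "\<And>w. \<phi> (basis w) = \<psi> (basis w)"
  shows "\<phi> p = \<psi> p"
  using linear_eqI[OF assms] by simp

lemma alg_hom_tensor_lift:
  assumes "bilinear_map pscale B" and "B 1 1 = 1"
    and "\<And>a b c d. B (a * c) (b * d) = B a b * B c d"
  shows "alg_hom pscale pscale (tensor_lift pscale B)"
proof -
  have "tensor_lift pscale B (p * q) = tensor_lift pscale B p * tensor_lift pscale B q" for p q
    unfolding tensor_lift_def
    by (rule lin_ext_mult[OF scalar_alg_pscale]) (simp add: assms(3)[symmetric] mult_single)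
  moreover have "tensor_lift pscale B 1 = 1"
    using tensor_lift_basis[of B 0 0] assms(2) by (simp add: flip: zero_prod_def)
  ultimately show ?thesis
    by (simp add: alg_hom_def linear_tensor_lift)
qed

lemma alg_homD:
  assumes "alg_hom s t \<phi>"
  shows "Vector_Spaces.linear s t \<phi>" "\<phi> 1 = 1" "\<phi> (a * b) = \<phi> a * \<phi> b"
    "\<phi> (a + b) = \<phi> a + \<phi> b" "\<phi> 0 = 0" "\<phi> (sum f A) = (\<Sum>x\<in>A. \<phi> (f x))" "\<phi> (s c a) = t c (\<phi> a)"
proof -
  show lin: "Vector_Spaces.linear s t \<phi>" and "\<phi> 1 = 1" and "\<phi> (a * b) = \<phi> a * \<phi> b"
    using assms by (auto simp: alg_hom_def)
  interpret Vector_Spaces.linear s t \<phi> by (rule lin)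
  show "\<phi> (a + b) = \<phi> a + \<phi> b" "\<phi> 0 = 0" "\<phi> (sum f A) = (\<Sum>x\<in>A. \<phi> (f x))" "\<phi> (s c a) = t c (\<phi> a)"
    by (rule add zero sum scale)+
qed

lemma alg_hom_comp: "alg_hom s t \<phi> \<Longrightarrow> alg_hom t u \<psi> \<Longrightarrow> alg_hom s u (\<psi> \<circ> \<phi>)"
  unfolding alg_hom_def using Vector_Spaces.linear_compose by auto

lemma alg_hom_id: "alg_hom pscale pscale (id :: ('m::monoid_add \<Rightarrow>\<^sub>0 'f::field) \<Rightarrow> _)"
  by (auto simp: alg_hom_def intro: linear_pscaleI)

section \<open>Images of power series under algebra homomorphisms\<close>

definition fps_map :: "('a::ring_1 \<Rightarrow> 'b::ring_1) \<Rightarrow> 'a fps \<Rightarrow> 'b fps" where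
  "fps_map \<phi> F = Abs_fps (\<lambda>n. \<phi> (F $ n))"

lemma fps_map_nth [simp]: "fps_map \<phi> F $ n = \<phi> (F $ n)"
  by (simp add: fps_map_def)

lemma fps_map_fps_map: "fps_map \<psi> (fps_map \<phi> F) = fps_map (\<psi> \<circ> \<phi>) F"
  by (simp add: fps_eq_iff)

lemma fps_map_id [simp]: "fps_map id F = F"
  by (simp add: fps_eq_iff)

text \<open>Every coefficient of a composite is a finite sum of products of coefficients. Identities
  between homomorphisms thereby become identities between series.\<close>

lemma fps_map_compose:
  assumes "alg_hom s t \<phi>"
  shows "fps_map \<phi> (F oo G) = fps_map \<phi> F oo fps_map \<phi> G"
proof -
  note [simp] = alg_homD(2,3,5,6)[OF assms]
  have "fps_map \<phi> (G ^ i) = fps_map \<phi> G ^ i" for i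
    by (induction i) (simp_all add: fps_eq_iff fps_mult_nth)
  then have "\<phi> ((G ^ i) $ n) = (fps_map \<phi> G ^ i) $ n" for i n
    by (metis fps_map_nth)
  then show ?thesis
    by (simp add: fps_eq_iff fps_compose_nth)
qed

lemma fps_map_ser: "alg_hom s t \<phi> \<Longrightarrow> fps_map \<phi> (ser a) = ser (\<lambda>n. \<phi> (a n))"
  by (simp add: fps_eq_iff ser_nth alg_homD(5))

section \<open>The coloop bialgebra\<close>

text \<open>The generic formal diffeomorphism: algebra maps out of \<open>'f fdb\<close> are its specialisations.\<close>

definition generic :: "'f::field fdb fps" where
  "generic = ser X"

lemma X_0 [simp]: "X 0 = 1"
  by (simp add: X_def)

lemma generic_nth_0: "generic $ 0 = 0" and generic_nth_1: "generic $ 1 = 1"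
  by (simp_all add: generic_def ser_nth)

lemma generic_hom_eqI:
  assumes "alg_hom pscale s \<phi>" "alg_hom pscale s \<psi>" and "fps_map \<phi> generic = fps_map \<psi> generic"
  shows "\<phi> = \<psi>"
proof (rule alg_hom_eqI[OF assms(1,2)])
  show "\<phi> (gen a) = \<psi> (gen a)" for a
    \<comment> \<open>The shift by 2 is one from \<open>ser\<close> and one because the letter
      \<open>a\<close> is the generator with index \<open>a + 1\<close>.\<close>
    using arg_cong[OF assms(3), of "\<lambda>F. F $ (a + 2)"] by (simp add: generic_def ser_nth X_def)
qed

lemma alg_hom_fdb_hom: "scalar_alg s \<Longrightarrow> alg_hom pscale s (fdb_hom s f)"
  unfolding fdb_hom_def by (rule alg_hom_free_lift)

lemma fps_map_fdb_hom:
  assumes "scalar_alg s" "f 0 = 1"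
  shows "fps_map (fdb_hom s f) generic = ser f"
proof -
  have "fdb_hom s f (X n) = f n" for n
    using assms alg_homD(2)[OF alg_hom_fdb_hom[OF assms(1)], of f] by (cases "n = 0") simp_all
  then show ?thesis
    by (simp add: generic_def fps_map_ser[OF alg_hom_fdb_hom[OF assms(1)]])
qed

lemma alg_hom_coprod_in:
  "alg_hom pscale pscale coprod_in1" "alg_hom pscale pscale coprod_in2"
  by (simp_all add: coprod_in1_def coprod_in2_def alg_hom_free_lift scalar_alg_pscale)

lemma alg_hom_coprod_lift: "alg_hom pscale pscale (coprod_lift f g)"
  by (simp add: coprod_lift_def alg_hom_free_lift scalar_alg_pscale)

lemma coprod_lift_comp_in:
  assumes "alg_hom pscale pscale f" "alg_hom pscale pscale g"
  shows "coprod_lift f g \<circ> coprod_in1 = f" "coprod_lift f g \<circ> coprod_in2 = g"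
  using coprod_lift_unique[OF assms, of "coprod_lift f g"] by simp_all

lemma alg_hom_fdb_comult: "alg_hom pscale pscale fdb_comult"
  unfolding fdb_comult_def by (rule alg_hom_fdb_hom[OF scalar_alg_pscale])

text \<open>The binomial formula for the comultiplication is the composition law of formal
  diffeomorphisms, read off at coefficient \<open>Suc m\<close> for the generator with index
  \<open>m\<close>.\<close>

lemma fps_map_fdb_comult:
  "fps_map fdb_comult generic = fps_map coprod_in1 generic oo (fps_map coprod_in2 generic :: ((nat + nat) fmon \<Rightarrow>\<^sub>0 'f::field) fps)"
proof (rule fps_ext)
  fix n
  note ser_in = fps_map_ser[OF alg_hom_coprod_in(1)] fps_map_ser[OF alg_hom_coprod_in(2)]
  have one: "coprod_in1 1 = (1 :: (nat + nat) fmon \<Rightarrow>\<^sub>0 'f)" "coprod_in2 1 = (1 :: (nat + nat) fmon \<Rightarrow>\<^sub>0 'f)"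
    by (rule alg_homD(2)[OF alg_hom_coprod_in(1)] alg_homD(2)[OF alg_hom_coprod_in(2)])+
  \<comment> \<open>The formula covers generators of index \<open>m \<ge> 1\<close>; coefficients 0
    and 1 come from the missing constant term and from \<open>X 0 = 1\<close>.\<close>
  consider "n = 0" | "n = 1" | m where "n = Suc m" "m \<ge> 1"
    by (metis One_nat_def Suc_le_eq not0_implies_Suc neq0_conv)
  then show "fps_map fdb_comult generic $ n =
      (fps_map coprod_in1 generic oo (fps_map coprod_in2 generic :: ((nat + nat) fmon \<Rightarrow>\<^sub>0 'f) fps)) $ n"
  proof cases
    case 3
    then show ?thesis
      unfolding generic_def fps_map_ser[OF alg_hom_fdb_comult] ser_in 3(1)
      by (subst ser_compose_nth_compositions)
        (simp_all add: ser_nth fdb_comult_def scalar_alg_pscale one del: binomial_Suc_Suc)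
  qed (simp_all add: generic_def fps_map_ser[OF alg_hom_fdb_comult] ser_in ser_nth ser_compose_nth
      ser_compose_nth[of _ _ 0, simplified] weak_compositions_1
      one alg_homD(2)[OF alg_hom_fdb_comult])
qed

lemma alg_hom_fdb_counit: "alg_hom pscale (*) fdb_counit"
  unfolding fdb_counit_def by (rule alg_hom_fdb_hom[OF scalar_alg_times])

definition unit_counit :: "'f::field fdb \<Rightarrow> 'f fdb" where
  "unit_counit h = pscale (fdb_counit h) 1"

lemma alg_hom_unit_counit: "alg_hom pscale pscale unit_counit"
  unfolding alg_hom_def unit_counit_def
  by (auto simp: alg_homD(2,3,4,7)[OF alg_hom_fdb_counit] lin_simps
      mult.commute[of "fdb_counit _" "fdb_counit _"] intro!: linear_pscaleI)

text \<open>Unit after counit kills all generators, so only the leading term of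
  \<open>generic\<close> remains: the neutral element for composition.\<close>

lemma fps_map_unit_counit: "fps_map unit_counit generic = (fps_X :: 'f::field fdb fps)"
proof -
  have "fdb_counit (X n) = (if n = 0 then 1 else 0 :: 'f)" for n
    using alg_homD(2)[OF alg_hom_fdb_counit, where 'a = 'f] by (simp add: fdb_counit_def scalar_alg_times)
  moreover have "pscale 0 1 = (0 :: 'f fdb)"
    by (rule poly_mapping_eqI) simp
  ultimately show ?thesis
    by (auto simp: fps_eq_iff generic_def ser_nth unit_counit_def pscale_one alg_homD(2,5)[OF alg_hom_fdb_counit])
qed

text \<open>Folding after \<open>coprod_map f g\<close> restricts to \<open>f\<close> and
  \<open>g\<close> on the two copies, hence sends the comultiplied \<open>generic\<close> to the
  composite of its images. The antipode axioms thus ask for a two-sided compositional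
  inverse.\<close>

lemma coloop_antipode_iff:
  assumes S: "alg_hom pscale pscale S"
  shows "coloop_antipode fdb_comult fdb_counit S \<longleftrightarrow>
    fps_map S generic oo generic = fps_X \<and> generic oo fps_map S generic = fps_X"
proof -
  have *: "(\<forall>h. folding (coprod_map f g (fdb_comult h)) = unit_counit h) \<longleftrightarrow>
      fps_map f generic oo fps_map g generic = fps_X"
    if f: "alg_hom pscale pscale f" and g: "alg_hom pscale pscale g" for f g :: "'a fdb \<Rightarrow> 'a fdb"
  proof -
    have "alg_hom pscale pscale (\<lambda>p. coprod_in1 (f p))" "alg_hom pscale pscale (\<lambda>p. coprod_in2 (g p))"
      using alg_hom_comp[OF f alg_hom_coprod_in(1)] alg_hom_comp[OF g alg_hom_coprod_in(2)]
      by (simp_all add: o_def)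
    note cp = coprod_lift_comp_in[OF this, folded coprod_map_def, THEN fun_cong, unfolded o_apply]
    note fo = coprod_lift_comp_in[OF alg_hom_id alg_hom_id, folded folding_def, THEN fun_cong, unfolded o_apply]
    define M where "M = folding \<circ> coprod_map f g"
    have hom: "alg_hom pscale pscale M"
      unfolding M_def folding_def coprod_map_def
      by (rule alg_hom_comp[OF alg_hom_coprod_lift alg_hom_coprod_lift])
    have M: "M \<circ> coprod_in1 = f" "M \<circ> coprod_in2 = g"
      by (auto simp: M_def cp fo)
    have "fps_map (M \<circ> fdb_comult) generic = fps_map f generic oo fps_map g generic"
      by (simp add: fps_map_fdb_comult fps_map_compose[OF hom] fps_map_fps_map M
          flip: fps_map_fps_map[of M fdb_comult])
    moreover have "(\<forall>h. folding (coprod_map f g (fdb_comult h)) = unit_counit h) \<longleftrightarrow>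
        M \<circ> fdb_comult = unit_counit"
      by (auto simp: M_def fun_eq_iff)
    ultimately show ?thesis
      using generic_hom_eqI[OF alg_hom_comp[OF alg_hom_fdb_comult hom] alg_hom_unit_counit]
        fps_map_unit_counit by metis
  qed
  show ?thesis
    unfolding coloop_antipode_def using S *[OF S alg_hom_id] *[OF alg_hom_id S]
    by (auto simp: unit_counit_def)
qed

lemma ex1_coloop_antipode:
  "\<exists>!S :: 'f::field fdb \<Rightarrow> 'f fdb. coloop_antipode fdb_comult fdb_counit S"
proof -
  let ?s = "Abs_fps (left_compinv (generic :: 'f fdb fps))"
  \<comment> \<open>\<open>ser\<close> shifts coefficients by one, so the generator with index
    \<open>n\<close> goes to coefficient \<open>n + 1\<close> of the inverse.\<close>
  let ?S = "fdb_hom pscale (\<lambda>n. ?s $ (n + 1)) :: 'f fdb \<Rightarrow> 'f fdb"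
  have left: "?s oo generic = fps_X"
    by (rule left_compinv) (rule generic_nth_0 generic_nth_1)+
  have right: "generic oo ?s = fps_X"
    by (rule left_inverse_imp_right_inverse[OF generic_nth_0 generic_nth_1 _ left]) simp
  have "ser (\<lambda>n. ?s $ (n + 1)) $ n = ?s $ n" for n
    by (cases n) (simp_all add: ser_nth)
  then have "fps_map ?S generic = ?s"
    by (subst fps_map_fdb_hom[OF scalar_alg_pscale]) (simp_all add: fps_eq_iff)
  then have "coloop_antipode fdb_comult fdb_counit ?S"
    using left right by (simp add: coloop_antipode_iff alg_hom_fdb_hom scalar_alg_pscale)
  moreover have "S = ?S" if "coloop_antipode fdb_comult fdb_counit S" for S
  proof (rule generic_hom_eqI)
    show S: "alg_hom pscale pscale S"
      using that by (simp add: coloop_antipode_def)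
    show S': "alg_hom pscale pscale ?S"
      by (rule alg_hom_fdb_hom[OF scalar_alg_pscale])
    show "fps_map S generic = fps_map ?S generic"
      \<comment> \<open>Both images of \<open>generic\<close> are left inverses of
        \<open>generic\<close>, which cancels on the right.\<close>
      by (rule fps_compose_left_cancel[OF generic_nth_0 generic_nth_1])
        (metis that \<open>coloop_antipode fdb_comult fdb_counit ?S\<close> coloop_antipode_iff S S')
  qed
  ultimately show ?thesis by blast
qed

section \<open>The tensor bialgebra\<close>

lemma tensor_one_one: "tensor 1 1 = (1 :: 'm::monoid_add \<times> 'n::monoid_add \<Rightarrow>\<^sub>0 'f::field)"
  using tensor_basis[of "0 :: 'm" "0 :: 'n"] by (simp flip: zero_prod_def)

lemma alg_hom_tensor_left: "alg_hom pscale pscale (\<lambda>h. tensor h (1 :: 'n::monoid_add \<Rightarrow>\<^sub>0 'f::field))"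
  and alg_hom_tensor_right: "alg_hom pscale pscale (\<lambda>h. tensor (1 :: 'm::monoid_add \<Rightarrow>\<^sub>0 'f::field) h)"
  by (auto simp: alg_hom_def lin_simps tensor_one_one tensor_mult intro!: linear_pscaleI)

lemma alg_hom_nc_comult: "alg_hom pscale pscale nc_comult"
  unfolding nc_comult_def by (rule alg_hom_fdb_hom[OF scalar_alg_pscale])

text \<open>\<open>fdb_hom\<close> prescribes values for \<open>n \<ge> 1\<close>. The formula
  persists at \<open>n = 0\<close>, so it can be used for all coefficients of a series.\<close>

lemma nc_comult_X:
  "nc_comult (X n) = (\<Sum>m=0..n.
     tensor (X m) (\<Sum>ks\<in>weak_compositions (n - m) (m + 1). prod_list (map X ks)))"
proof (cases "n = 0")
  case True
  have "nc_comult 1 = 1"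
    by (rule alg_homD(2)[OF alg_hom_nc_comult])
  with True show ?thesis
    by (simp add: weak_compositions_1 tensor_one_one)
qed (simp add: nc_comult_def scalar_alg_pscale)

text \<open>Splitting \<open>tensor a b\<close> into \<open>tensor a 1 * tensor 1 b\<close> brings
  the defining formula into the form of \<open>ser_compose_nth\<close>.\<close>

lemma fps_map_nc_comult:
  "fps_map nc_comult generic =
    fps_map (\<lambda>h. tensor h 1) generic oo (fps_map (\<lambda>h. tensor 1 h) generic :: (nat fmon \<times> nat fmon \<Rightarrow>\<^sub>0 'f::field) fps)"
proof (rule fps_ext)
  fix n
  have T1: "alg_hom pscale pscale (\<lambda>h :: 'f fdb. tensor h (1 :: 'f fdb))"
    and T2: "alg_hom pscale pscale (\<lambda>h :: 'f fdb. tensor (1 :: 'f fdb) h)"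
    by (rule alg_hom_tensor_left alg_hom_tensor_right)+
  note ser = fps_map_ser[OF alg_hom_nc_comult] fps_map_ser[OF T1] fps_map_ser[OF T2]
  have "tensor a b = tensor a 1 * tensor 1 b" for a b :: "'f fdb"
    by (simp add: tensor_mult)
  moreover have "tensor 1 (\<Sum>ks\<in>A. prod_list (map X ks)) =
      (\<Sum>ks\<in>A. prod_list (map (\<lambda>k. tensor (1 :: 'f fdb) (X k :: 'f fdb)) ks))" for A
    by (simp add: alg_homD(6)[OF T2] alg_hom_prod_list[OF T2] o_def)
  ultimately have "nc_comult (X m) =
      (ser (\<lambda>n. tensor (X n :: 'f fdb) (1 :: 'f fdb)) oo ser (\<lambda>n. tensor 1 (X n))) $ Suc m" for m
    unfolding nc_comult_X ser_compose_nth by metis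
  then show "fps_map nc_comult generic $ n = (fps_map (\<lambda>h. tensor h 1) generic oo
      (fps_map (\<lambda>h. tensor 1 h) generic :: (nat fmon \<times> nat fmon \<Rightarrow>\<^sub>0 'f) fps)) $ n"
    unfolding generic_def ser by (cases n) (simp_all add: ser_nth)
qed

text \<open>The projection carries the two copies in the coproduct to the two tensor factors, so
  both sides send \<open>generic\<close> to the same composite.\<close>

lemma canonical_proj_fdb_comult: "canonical_proj \<circ> fdb_comult = (nc_comult :: 'f::field fdb \<Rightarrow> _)"
proof (rule generic_hom_eqI)
  have P: "alg_hom pscale pscale (canonical_proj :: ((nat + nat) fmon \<Rightarrow>\<^sub>0 'f) \<Rightarrow> _)"
    unfolding canonical_proj_def by (rule alg_hom_coprod_lift)
  show "alg_hom pscale pscale (canonical_proj \<circ> (fdb_comult :: 'f fdb \<Rightarrow> _))"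
    by (rule alg_hom_comp[OF alg_hom_fdb_comult P])
  show "alg_hom pscale pscale (nc_comult :: 'f fdb \<Rightarrow> _)"
    by (rule alg_hom_nc_comult)
  show "fps_map (canonical_proj \<circ> fdb_comult) generic = fps_map (nc_comult :: 'f fdb \<Rightarrow> _) generic"
    unfolding fps_map_fps_map[symmetric] fps_map_fdb_comult fps_map_compose[OF P] fps_map_nc_comult
    by (simp add: fps_map_fps_map canonical_proj_def
        coprod_lift_comp_in[OF alg_hom_tensor_left alg_hom_tensor_right])
qed

section \<open>Coassociativity and counit of the tensor bialgebra\<close>

lemma bilinear_pscaleI:
  assumes "\<And>a a' b. B (a + a') b = B a b + B a' b" "\<And>c a b. B (pscale c a) b = pscale c (B a b)"
    and "\<And>a b b'. B a (b + b') = B a b + B a b'" "\<And>c a b. B a (pscale c b) = pscale c (B a b)"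
  shows "bilinear_map pscale B"
  using assms by (auto simp: bilinear_map_def intro!: linear_pscaleI)

lemma bilinear_tensor_map:
  assumes "alg_hom pscale pscale f" "alg_hom pscale pscale g"
  shows "bilinear_map pscale (\<lambda>a b. tensor (f a) (g b))"
  by (rule bilinear_pscaleI) (simp_all add: alg_homD(4,7)[OF assms(1)] alg_homD(4,7)[OF assms(2)] lin_simps)

lemma tensor_map_tensor:
  assumes "alg_hom pscale pscale f" "alg_hom pscale pscale g"
  shows "tensor_map f g (tensor a b) = tensor (f a) (g b)"
  unfolding tensor_map_def by (rule tensor_lift_tensor[OF bilinear_tensor_map[OF assms]])

lemma alg_hom_tensor_map:
  assumes "alg_hom pscale pscale f" "alg_hom pscale pscale g"
  shows "alg_hom pscale pscale (tensor_map f g)"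
  unfolding tensor_map_def
  by (rule alg_hom_tensor_lift[OF bilinear_tensor_map[OF assms]])
    (simp_all add: alg_homD(2,3)[OF assms(1)] alg_homD(2,3)[OF assms(2)] tensor_one_one tensor_mult)

text \<open>On basis elements rebracketing is a monoid isomorphism, which gives multiplicativity
  through \<open>lin_ext_mult\<close>; the nested \<open>tensor_lift\<close> hides this.\<close>

lemma tensor_assoc_conv: "tensor_assoc = lin_ext pscale (\<lambda>((u, v), w). basis (u, v, w))"
  by (simp add: tensor_assoc_def tensor_lift_def[of _ "\<lambda>ab c. _ ab c"] split_def)
    (simp add: tensor_lift_def vector_space_pscale tensor_basis split_def)

lemma tensor_assoc_basis: "tensor_assoc (basis ((u, v), w)) = basis (u, v, w)"
  by (simp add: tensor_assoc_conv vector_space_pscale)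

lemma alg_hom_tensor_assoc:
  "alg_hom pscale pscale (tensor_assoc :: (('m::monoid_add \<times> 'n::monoid_add) \<times> 'k::monoid_add \<Rightarrow>\<^sub>0 'f::field) \<Rightarrow> _)"
proof -
  have "tensor_assoc (p * q) = tensor_assoc p * tensor_assoc q" for p q :: "('m \<times> 'n) \<times> 'k \<Rightarrow>\<^sub>0 'f"
    unfolding tensor_assoc_conv
    by (rule lin_ext_mult[OF scalar_alg_pscale]) (simp add: mult_single split_def)
  moreover have "tensor_assoc (1 :: ('m \<times> 'n) \<times> 'k \<Rightarrow>\<^sub>0 'f) = 1"
    using tensor_assoc_basis[of "0 :: 'm" "0 :: 'n" "0 :: 'k"] by (simp flip: zero_prod_def)
  moreover have "Vector_Spaces.linear pscale pscale (tensor_assoc :: (('m \<times> 'n) \<times> 'k \<Rightarrow>\<^sub>0 'f) \<Rightarrow> _)"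
    unfolding tensor_assoc_def by (rule linear_tensor_lift)
  ultimately show ?thesis
    by (simp add: alg_hom_def)
qed

lemma tensor_basis_one: "tensor (basis u) (1 :: 'n::monoid_add \<Rightarrow>\<^sub>0 'f::field) = basis (u, 0)"
  and tensor_one_basis: "tensor (1 :: 'm::monoid_add \<Rightarrow>\<^sub>0 'f::field) (basis v) = basis (0, v)"
  using tensor_basis[of u "0 :: 'n"] tensor_basis[of "0 :: 'm" v] by simp_all

lemma nc_comult_coassoc:
  fixes h :: "'f::field fdb"
  shows "tensor_assoc (tensor_map nc_comult id (nc_comult h)) = tensor_map id nc_comult (nc_comult h)"
proof -
  define D :: "'f fdb \<Rightarrow> _" where "D = nc_comult"
  \<comment> \<open>\<open>E1\<close>, \<open>E2\<close>, \<open>E3\<close> embed the algebra into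
    the three tensor factors, \<open>T1\<close> and \<open>T2\<close> into two; \<open>L1\<close>
    and \<open>R2\<close> embed a double tensor product into the first two and the last two of three
    factors.\<close>
  define E1 :: "'f fdb \<Rightarrow> (nat fmon \<times> nat fmon \<times> nat fmon \<Rightarrow>\<^sub>0 'f)" where "E1 = (\<lambda>h. tensor h 1)"
  define E2 :: "'f fdb \<Rightarrow> (nat fmon \<times> nat fmon \<times> nat fmon \<Rightarrow>\<^sub>0 'f)" where "E2 = (\<lambda>h. tensor 1 (tensor h 1))"
  define E3 :: "'f fdb \<Rightarrow> (nat fmon \<times> nat fmon \<times> nat fmon \<Rightarrow>\<^sub>0 'f)" where "E3 = (\<lambda>h. tensor 1 (tensor 1 h))"
  define T1 :: "'f fdb \<Rightarrow> (nat fmon \<times> nat fmon \<Rightarrow>\<^sub>0 'f)" where "T1 = (\<lambda>h. tensor h 1)"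
  define T2 :: "'f fdb \<Rightarrow> (nat fmon \<times> nat fmon \<Rightarrow>\<^sub>0 'f)" where "T2 = (\<lambda>h. tensor 1 h)"
  define L1 :: "(nat fmon \<times> nat fmon \<Rightarrow>\<^sub>0 'f) \<Rightarrow> (nat fmon \<times> nat fmon \<times> nat fmon \<Rightarrow>\<^sub>0 'f)"
    where "L1 = tensor_assoc \<circ> (\<lambda>p. tensor p 1)"
  define R2 :: "(nat fmon \<times> nat fmon \<Rightarrow>\<^sub>0 'f) \<Rightarrow> (nat fmon \<times> nat fmon \<times> nat fmon \<Rightarrow>\<^sub>0 'f)"
    where "R2 = tensor 1"
  define A :: "(nat fmon \<times> nat fmon \<Rightarrow>\<^sub>0 'f) \<Rightarrow> (nat fmon \<times> nat fmon \<times> nat fmon \<Rightarrow>\<^sub>0 'f)"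
    where "A = tensor_assoc \<circ> tensor_map D id"
  define B :: "(nat fmon \<times> nat fmon \<Rightarrow>\<^sub>0 'f) \<Rightarrow> (nat fmon \<times> nat fmon \<times> nat fmon \<Rightarrow>\<^sub>0 'f)"
    where "B = tensor_map id D"
  have D: "alg_hom pscale pscale D"
    by (simp add: D_def alg_hom_nc_comult)
  have A: "alg_hom pscale pscale A"
    unfolding A_def by (rule alg_hom_comp[OF alg_hom_tensor_map[OF D alg_hom_id] alg_hom_tensor_assoc])
  have B: "alg_hom pscale pscale B"
    unfolding B_def by (rule alg_hom_tensor_map[OF alg_hom_id D])
  have T: "alg_hom pscale pscale T1" "alg_hom pscale pscale T2"
    by (simp_all add: T1_def T2_def alg_hom_tensor_left alg_hom_tensor_right)
  have L1: "alg_hom pscale pscale L1"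
    unfolding L1_def by (rule alg_hom_comp[OF alg_hom_tensor_left alg_hom_tensor_assoc])
  have R2: "alg_hom pscale pscale R2"
    by (simp add: R2_def alg_hom_tensor_right)
  have E1: "alg_hom pscale pscale E1"
    by (simp add: E1_def alg_hom_tensor_left)
  have E2: "alg_hom pscale pscale E2" and E3: "alg_hom pscale pscale E3"
    using alg_hom_comp[OF T(1) R2] alg_hom_comp[OF T(2) R2]
    by (simp_all add: E2_def E3_def T1_def T2_def R2_def o_def)
  have L1T: "L1 \<circ> T1 = E1" "L1 \<circ> T2 = E2"
    by (rule alg_hom_eqI[OF alg_hom_comp[OF T(1) L1] E1] alg_hom_eqI[OF alg_hom_comp[OF T(2) L1] E2];
      simp add: L1_def T1_def T2_def E1_def E2_def gen_def tensor_basis_one tensor_one_basis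
        tensor_assoc_basis flip: zero_prod_def)+
  have AT1: "A \<circ> T1 = L1 \<circ> D"
    by (simp add: fun_eq_iff A_def T1_def L1_def tensor_map_tensor[OF D alg_hom_id])
  have AT2: "A \<circ> T2 = E3"
    by (rule alg_hom_eqI[OF alg_hom_comp[OF T(2) A] E3])
      (simp add: A_def T2_def E3_def tensor_map_tensor[OF D alg_hom_id] alg_homD(2)[OF D],
       simp add: gen_def tensor_one_basis zero_prod_def tensor_assoc_basis)
  have BT: "B \<circ> T1 = E1" "B \<circ> T2 = R2 \<circ> D"
    by (simp_all add: fun_eq_iff B_def T1_def T2_def E1_def R2_def
        tensor_map_tensor[OF alg_hom_id D] alg_homD(2)[OF D])
  have RT: "R2 \<circ> T1 = E2" "R2 \<circ> T2 = E3"
    by (simp_all add: fun_eq_iff R2_def T1_def T2_def E2_def E3_def)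
  have D_gen: "fps_map D generic = fps_map T1 generic oo fps_map T2 generic"
    unfolding D_def T1_def T2_def by (rule fps_map_nc_comult)
  have "fps_map (A \<circ> D) generic = fps_map (L1 \<circ> D) generic oo fps_map E3 generic"
    by (simp add: D_gen fps_map_compose[OF A] fps_map_fps_map AT1 AT2 flip: fps_map_fps_map[of A D])
  also have "fps_map (L1 \<circ> D) generic = fps_map E1 generic oo fps_map E2 generic"
    by (simp add: D_gen fps_map_compose[OF L1] fps_map_fps_map L1T flip: fps_map_fps_map[of L1 D])
  \<comment> \<open>Elements of the second and third tensor factors commute, which supplies the
    hypothesis of associativity.\<close>
  also have "(fps_map E1 generic oo fps_map E2 generic) oo fps_map E3 generic =
      fps_map E1 generic oo (fps_map E2 generic oo fps_map E3 generic)"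
    by (intro fps_compose_assoc_commuting fps_compose_commutes)
      (simp_all add: generic_nth_0 alg_homD(5)[OF E2] alg_homD(5)[OF E3], simp add: E2_def E3_def tensor_mult)
  also have "fps_map E2 generic oo fps_map E3 generic = fps_map (R2 \<circ> D) generic"
    by (simp add: D_gen fps_map_compose[OF R2] fps_map_fps_map RT flip: fps_map_fps_map[of R2 D])
  also have "fps_map E1 generic oo fps_map (R2 \<circ> D) generic = fps_map (B \<circ> D) generic"
    by (simp add: D_gen fps_map_compose[OF B] fps_map_fps_map BT flip: fps_map_fps_map[of B D])
  finally have "A \<circ> D = B \<circ> D"
    by (rule generic_hom_eqI[OF alg_hom_comp[OF D A] alg_hom_comp[OF D B]])
  then show ?thesis
    by (simp add: fun_eq_iff A_def B_def D_def)
qed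

text \<open>The counit turns one of the two copies of \<open>generic\<close> into the neutral series
  \<open>fps_X\<close>, and the other copy is what remains.\<close>

lemma nc_counit:
  fixes h :: "'f::field fdb"
  shows "tensor_lift pscale (\<lambda>a b. pscale (fdb_counit a) b) (nc_comult h) = h"
    and "tensor_lift pscale (\<lambda>a b. pscale (fdb_counit b) a) (nc_comult h) = h"
proof -
  note \<epsilon> = alg_homD(2,3,4,7)[OF alg_hom_fdb_counit]
  define L :: "_ \<Rightarrow> 'f fdb" where "L = tensor_lift pscale (\<lambda>a b. pscale (fdb_counit a) b)"
  define R :: "_ \<Rightarrow> 'f fdb" where "R = tensor_lift pscale (\<lambda>a b. pscale (fdb_counit b) a)"
  have bl: "bilinear_map pscale (\<lambda>a b :: 'f fdb. pscale (fdb_counit a) b)"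
    and br: "bilinear_map pscale (\<lambda>a b :: 'f fdb. pscale (fdb_counit b) a)"
    by (rule bilinear_pscaleI; simp add: \<epsilon> lin_simps mult.commute)+
  \<comment> \<open>These maps are multiplicative because values of the counit are scalars, hence
    central.\<close>
  have L: "alg_hom pscale pscale L" and R: "alg_hom pscale pscale R"
    unfolding L_def R_def
    by (rule alg_hom_tensor_lift[OF bl] alg_hom_tensor_lift[OF br]; simp add: \<epsilon> lin_simps mult.commute)+
  have L_simps: "L (tensor a b) = pscale (fdb_counit a) b" and R_simps: "R (tensor a b) = pscale (fdb_counit b) a" for a b
    unfolding L_def R_def by (rule tensor_lift_tensor[OF bl] tensor_lift_tensor[OF br])+
  have comps: "L \<circ> (\<lambda>h. tensor h 1) = unit_counit" "L \<circ> (\<lambda>h. tensor 1 h) = id"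
     "R \<circ> (\<lambda>h. tensor h 1) = id" "R \<circ> (\<lambda>h. tensor 1 h) = unit_counit"
    by (simp_all add: fun_eq_iff L_simps R_simps unit_counit_def \<epsilon> lin_simps)
  have "fps_map (L \<circ> nc_comult) generic = fps_map id generic"
    unfolding fps_map_fps_map[symmetric] fps_map_nc_comult fps_map_compose[OF L]
    by (simp add: fps_map_fps_map comps fps_map_unit_counit fps_X_compose_left generic_nth_0)
  then have "L \<circ> nc_comult = id"
    by (rule generic_hom_eqI[OF alg_hom_comp[OF alg_hom_nc_comult L] alg_hom_id])
  then show "tensor_lift pscale (\<lambda>a b. pscale (fdb_counit a) b) (nc_comult h) = h"
    by (simp add: fun_eq_iff L_def)
  have "fps_map (R \<circ> nc_comult) generic = fps_map id generic"
    unfolding fps_map_fps_map[symmetric] fps_map_nc_comult fps_map_compose[OF R]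
    by (simp add: fps_map_fps_map comps fps_map_unit_counit fps_compose_X_right)
  then have "R \<circ> nc_comult = id"
    by (rule generic_hom_eqI[OF alg_hom_comp[OF alg_hom_nc_comult R] alg_hom_id])
  then show "tensor_lift pscale (\<lambda>a b. pscale (fdb_counit b) a) (nc_comult h) = h"
    by (simp add: fun_eq_iff R_def)
qed

lemma bialgebra_nc: "bialgebra nc_comult fdb_counit"
  by (simp add: bialgebra_def alg_hom_nc_comult alg_hom_fdb_counit nc_comult_coassoc nc_counit)

section \<open>Antipodes\<close>

abbreviation lin :: "(('m \<Rightarrow>\<^sub>0 'f::field) \<Rightarrow> ('n \<Rightarrow>\<^sub>0 'f)) \<Rightarrow> bool" where
  "lin \<equiv> Vector_Spaces.linear pscale pscale"

lemma lin_comp: "lin f \<Longrightarrow> lin g \<Longrightarrow> lin (\<lambda>x. g (f x))"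
  using Vector_Spaces.linear_compose[of pscale pscale f pscale g] by (simp add: o_def)

lemma lin_mult_left: "lin f \<Longrightarrow> lin (\<lambda>x. c * f x)"
  and lin_mult_right: "lin f \<Longrightarrow> lin (\<lambda>x. f x * c)"
  for c :: "'m::monoid_add \<Rightarrow>\<^sub>0 'f::field"
  by (auto intro!: linear_pscaleI simp: linear_pscaleD lin_simps)

lemma lin_pscale: "lin f \<Longrightarrow> lin (\<lambda>x. pscale c (f x))"
  by (auto intro!: linear_pscaleI simp: linear_pscaleD lin_simps mult.commute)

lemma lin_tensor_left: "lin f \<Longrightarrow> lin (\<lambda>x. tensor (f x) c)"
  and lin_tensor_right: "lin f \<Longrightarrow> lin (\<lambda>x. tensor c (f x))"
  by (auto intro!: linear_pscaleI simp: linear_pscaleD lin_simps)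

lemma lin_ident: "lin (\<lambda>x. x)"
  by (auto intro!: linear_pscaleI)

lemma lin_tensor_lift: "lin f \<Longrightarrow> lin (\<lambda>x. tensor_lift pscale B (f x))"
  by (rule lin_comp[OF _ linear_tensor_lift])

lemmas lin_intros = lin_mult_left lin_mult_right lin_pscale lin_tensor_left lin_tensor_right
  lin_tensor_lift lin_ident

section \<open>Convolution and uniqueness of the Hopf antipode\<close>

lemma bilinear_mult:
  fixes f g :: "_ \<Rightarrow> ('m::monoid_add \<Rightarrow>\<^sub>0 'f::field)"
  assumes "lin f" "lin g"
  shows "bilinear_map pscale (\<lambda>a b. f a * g b)"
  unfolding bilinear_map_def using assms by (auto intro: lin_intros)

text \<open>The convolution product of linear maps; a Hopf antipode is a two-sided convolution
  inverse of the identity.\<close>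

definition conv where
  "conv \<Delta> f g h = tensor_lift pscale (\<lambda>a b. f a * g b) (\<Delta> h)"

lemma lin_conv: "lin \<Delta> \<Longrightarrow> lin (conv \<Delta> f g)"
  unfolding conv_def by (rule lin_tensor_lift)

text \<open>A single map \<open>M\<close> on the triple tensor product, multiplying the values of
  \<open>f\<close>, \<open>g\<close> and \<open>h\<close>, yields both sides when applied to the two
  sides of coassociativity.\<close>

lemma conv_assoc:
  fixes \<Delta> :: "('m::monoid_add \<Rightarrow>\<^sub>0 'f::field) \<Rightarrow> ('m \<times> 'm \<Rightarrow>\<^sub>0 'f)"
    and f g h :: "('m \<Rightarrow>\<^sub>0 'f) \<Rightarrow> ('n::monoid_add \<Rightarrow>\<^sub>0 'f)"
  assumes \<Delta>: "alg_hom pscale pscale \<Delta>"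
    and coassoc: "\<And>x. tensor_assoc (tensor_map \<Delta> id (\<Delta> x)) = tensor_map id \<Delta> (\<Delta> x)"
    and f: "lin f" and g: "lin g" and h: "lin h"
  shows "conv \<Delta> (conv \<Delta> f g) h = conv \<Delta> f (conv \<Delta> g h)"
proof
  fix x
  note \<Delta>_lin = alg_homD(1)[OF \<Delta>]
  define M :: "('m \<times> 'm \<times> 'm \<Rightarrow>\<^sub>0 'f) \<Rightarrow> ('n \<Rightarrow>\<^sub>0 'f)" where
    "M = lin_ext pscale (\<lambda>(u, v, w). f (basis u) * g (basis v) * h (basis w))"
  have M: "lin M"
    unfolding M_def by (rule linear_lin_ext[OF vector_space_pscale])
  have M_basis: "M (basis (u, v, w)) = f (basis u) * g (basis v) * h (basis w)" for u v w
    by (simp add: M_def vector_space_pscale)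
  have tmap: "lin (tensor_map \<Delta> id)" "lin (tensor_map id \<Delta>)"
    by (simp_all add: tensor_map_def linear_tensor_lift)
  have tassoc: "lin (tensor_assoc :: (('m \<times> 'm) \<times> 'm \<Rightarrow>\<^sub>0 'f) \<Rightarrow> _)"
    by (rule alg_homD(1)[OF alg_hom_tensor_assoc])
  \<comment> \<open>The element \<open>q\<close> is kept arbitrary because it becomes
    \<open>\<Delta>\<close> of a basis element.\<close>
  have M_left: "M (tensor_assoc (tensor q (basis w))) =
      tensor_lift pscale (\<lambda>a b. f a * g b) q * h (basis w)" for q w
  proof (rule linear_eqI'[where p = q])
    show "lin (\<lambda>q. M (tensor_assoc (tensor q (basis w))))"
      by (intro lin_comp[OF _ M] lin_comp[OF _ tassoc] lin_tensor_left lin_ident)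
    show "lin (\<lambda>q. tensor_lift pscale (\<lambda>a b. f a * g b) q * h (basis w))"
      by (intro lin_intros)
    show "M (tensor_assoc (tensor (basis uv) (basis w))) =
      tensor_lift pscale (\<lambda>a b. f a * g b) (basis uv) * h (basis w)" for uv
      by (cases uv) (simp add: tensor_basis tensor_assoc_basis M_basis)
  qed
  have M_right: "M (tensor (basis u) q) =
      f (basis u) * tensor_lift pscale (\<lambda>a b. g a * h b) q" for q u
  proof (rule linear_eqI'[where p = q])
    show "lin (\<lambda>q. M (tensor (basis u) q))"
      by (intro lin_comp[OF _ M] lin_tensor_right lin_ident)
    show "lin (\<lambda>q. f (basis u) * tensor_lift pscale (\<lambda>a b. g a * h b) q)"
      by (intro lin_intros)
    show "M (tensor (basis u) (basis vw)) =
      f (basis u) * tensor_lift pscale (\<lambda>a b. g a * h b) (basis vw)" for vw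
      by (cases vw) (simp add: tensor_basis M_basis mult.assoc)
  qed
  have "tensor_lift pscale (\<lambda>a b. conv \<Delta> f g a * h b) p = M (tensor_assoc (tensor_map \<Delta> id p))" for p
  proof (rule linear_eqI'[OF linear_tensor_lift])
    show "lin (\<lambda>p. M (tensor_assoc (tensor_map \<Delta> id p)))"
      by (intro lin_comp[OF _ M] lin_comp[OF _ tassoc] tmap)
    show "tensor_lift pscale (\<lambda>a b. conv \<Delta> f g a * h b) (basis uv) =
      M (tensor_assoc (tensor_map \<Delta> id (basis uv)))" for uv
      by (cases uv) (simp add: conv_def tensor_map_tensor[OF \<Delta> alg_hom_id] M_left flip: tensor_basis,
          simp add: tensor_basis conv_def)
  qed
  moreover have "tensor_lift pscale (\<lambda>a b. f a * conv \<Delta> g h b) p = M (tensor_map id \<Delta> p)" for p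
  proof (rule linear_eqI'[OF linear_tensor_lift])
    show "lin (\<lambda>p. M (tensor_map id \<Delta> p))"
      by (intro lin_comp[OF _ M] tmap)
    show "tensor_lift pscale (\<lambda>a b. f a * conv \<Delta> g h b) (basis uv) =
      M (tensor_map id \<Delta> (basis uv))" for uv
      by (cases uv) (simp add: conv_def tensor_map_tensor[OF alg_hom_id \<Delta>] M_right flip: tensor_basis,
          simp add: tensor_basis conv_def)
  qed
  ultimately show "conv \<Delta> (conv \<Delta> f g) h x = conv \<Delta> f (conv \<Delta> g h) x"
    unfolding conv_def[of \<Delta> "conv \<Delta> f g"] conv_def[of \<Delta> f "conv \<Delta> g h"]
    by (simp only: coassoc)
qed

text \<open>Inverses in a monoid are unique: bracketing the convolution of \<open>S\<close>, the
  identity and \<open>S'\<close> in two ways gives \<open>S'\<close> and \<open>S\<close>. By the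
  counit axioms \<open>e\<close> is neutral.\<close>

lemma hopf_antipode_unique:
  fixes \<Delta> :: "('m::monoid_add \<Rightarrow>\<^sub>0 'f::field) \<Rightarrow> ('m \<times> 'm \<Rightarrow>\<^sub>0 'f)"
  assumes bi: "bialgebra \<Delta> \<epsilon>" and S: "hopf_antipode \<Delta> \<epsilon> S" and S': "hopf_antipode \<Delta> \<epsilon> S'"
  shows "S = S'"
proof -
  note bi' = bi[unfolded bialgebra_def]
  define e :: "('m \<Rightarrow>\<^sub>0 'f) \<Rightarrow> ('m \<Rightarrow>\<^sub>0 'f)" where "e x = pscale (\<epsilon> x) 1" for x
  have S_lin: "lin S" and S'_lin: "lin S'"
    using S S' by (simp_all add: hopf_antipode_def)
  have conv_S: "conv \<Delta> S (\<lambda>x. x) = e" "conv \<Delta> (\<lambda>x. x) S' = e"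
    using S S' by (simp_all add: fun_eq_iff hopf_antipode_def conv_def e_def)
  have "conv \<Delta> e f = f" if f: "lin f" for f
  proof
    fix x
    have "tensor_lift pscale (\<lambda>a b. e a * f b) p = f (tensor_lift pscale (\<lambda>a b. pscale (\<epsilon> a) b) p)" for p
      by (rule linear_eqI'[OF linear_tensor_lift lin_comp[OF linear_tensor_lift f]])
        (simp add: e_def lin_simps linear_pscaleD(2)[OF f] split_paired_all)
    then show "conv \<Delta> e f x = f x"
      using bi' by (simp add: conv_def)
  qed
  moreover have "conv \<Delta> f e = f" if f: "lin f" for f
  proof
    fix x
    have "tensor_lift pscale (\<lambda>a b. f a * e b) p = f (tensor_lift pscale (\<lambda>a b. pscale (\<epsilon> b) a) p)" for p
      by (rule linear_eqI'[OF linear_tensor_lift lin_comp[OF linear_tensor_lift f]])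
        (simp add: e_def lin_simps linear_pscaleD(2)[OF f] split_paired_all)
    then show "conv \<Delta> f e x = f x"
      using bi' by (simp add: conv_def)
  qed
  moreover have "conv \<Delta> (conv \<Delta> S (\<lambda>x. x)) S' = conv \<Delta> S (conv \<Delta> (\<lambda>x. x) S')"
    using bi' by (intro conv_assoc S_lin S'_lin lin_ident) auto
  ultimately show ?thesis
    using S_lin S'_lin by (simp add: conv_S)
qed

text \<open>Since \<open>T\<close> reverses products, \<open>T (a * a') * (b * b')\<close> is
  \<open>T a' * (T a * b) * b'\<close>: the convolution at \<open>x\<close> sits inside, and once it
  is scalar it can be pulled out. In the second identity the convolution at \<open>y\<close> is the
  inner one.\<close>

lemma conv_antihom_mult:
  fixes \<Delta> :: "('m::monoid_add \<Rightarrow>\<^sub>0 'f::field) \<Rightarrow> ('m \<times> 'm \<Rightarrow>\<^sub>0 'f)"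
  assumes \<Delta>: "alg_hom pscale pscale \<Delta>" and T: "alg_antihom pscale pscale T"
  shows "conv \<Delta> T (\<lambda>x. x) x = pscale c 1 \<Longrightarrow>
      conv \<Delta> T (\<lambda>x. x) (x * y) = pscale c (conv \<Delta> T (\<lambda>x. x) y)"
    and "conv \<Delta> (\<lambda>x. x) T y = pscale d 1 \<Longrightarrow>
      conv \<Delta> (\<lambda>x. x) T (x * y) = pscale d (conv \<Delta> (\<lambda>x. x) T x)"
proof -
  have T_lin: "lin T" and T_mult: "\<And>a b. T (a * b) = T b * T a"
    using T by (simp_all add: alg_antihom_def)
  have T_add: "T (basis (u + v)) = T (basis v) * T (basis u)" for u v
    by (simp add: mult_single flip: T_mult)
  have basis_add: "basis (u + v) = basis u * (basis v :: 'm \<Rightarrow>\<^sub>0 'f)" for u v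
    by (simp add: mult_single)
  define L where "L = tensor_lift pscale (\<lambda>a b. T a * b)"
  define R where "R = tensor_lift pscale (\<lambda>a b. a * T b)"
  have L: "lin L" and R: "lin R"
    by (simp_all add: L_def R_def linear_tensor_lift)
  have L_mult: "L (p * basis (u, v)) = T (basis u) * L p * basis v" for p u v
  proof (rule linear_eqI'[where p = p])
    show "lin (\<lambda>p. L (p * basis (u, v)))" "lin (\<lambda>p. T (basis u) * L p * basis v)"
      by (intro lin_comp[OF _ L] lin_intros L)+
    show "L (basis w * basis (u, v)) = T (basis u) * L (basis w) * basis v" for w
      by (cases w) (simp add: L_def mult_single T_add mult.assoc)
  qed
  have R_mult: "R (basis (u, v) * p) = basis u * R p * T (basis v)" for p u v
  proof (rule linear_eqI'[where p = p])
    show "lin (\<lambda>p. R (basis (u, v) * p))" "lin (\<lambda>p. basis u * R p * T (basis v))"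
      by (intro lin_comp[OF _ R] lin_intros R)+
    show "R (basis (u, v) * basis w) = basis u * R (basis w) * T (basis v)" for w
      by (cases w) (simp add: R_def mult_single, simp only: T_mult basis_add mult.assoc)
  qed
  {
    assume x: "conv \<Delta> T (\<lambda>x. x) x = pscale c 1"
    have "L (\<Delta> x * q) = pscale c (L q)" for q
    proof (rule linear_eqI'[where p = q])
      show "lin (\<lambda>q. L (\<Delta> x * q))" "lin (\<lambda>q. pscale c (L q))"
        by (intro lin_comp[OF _ L] lin_intros L)+
      show "L (\<Delta> x * basis w) = pscale c (L (basis w))" for w
        using x by (cases w) (simp add: L_mult conv_def lin_simps flip: L_def, simp add: L_def)
    qed
    then show "conv \<Delta> T (\<lambda>x. x) (x * y) = pscale c (conv \<Delta> T (\<lambda>x. x) y)"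
      by (simp add: conv_def alg_homD(3)[OF \<Delta>] flip: L_def)
  }
  {
    assume y: "conv \<Delta> (\<lambda>x. x) T y = pscale d 1"
    have "R (q * \<Delta> y) = pscale d (R q)" for q
    proof (rule linear_eqI'[where p = q])
      show "lin (\<lambda>q. R (q * \<Delta> y))" "lin (\<lambda>q. pscale d (R q))"
        by (intro lin_comp[OF _ R] lin_intros R)+
      show "R (basis w * \<Delta> y) = pscale d (R (basis w))" for w
        using y by (cases w) (simp add: R_mult conv_def lin_simps flip: R_def, simp add: R_def)
    qed
    then show "conv \<Delta> (\<lambda>x. x) T (x * y) = pscale d (conv \<Delta> (\<lambda>x. x) T x)"
      by (simp add: conv_def alg_homD(3)[OF \<Delta>] flip: R_def)
  }
qed

text \<open>Linearity reduces everything to words, treated letter by letter with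
  \<open>conv_antihom_mult\<close>: in the left identity the first letter is the inner factor, in
  the right one the rest of the word.\<close>

lemma hopf_antipode_antihomI:
  fixes \<Delta> :: "('a fmon \<Rightarrow>\<^sub>0 'f::field) \<Rightarrow> ('a fmon \<times> 'a fmon \<Rightarrow>\<^sub>0 'f)"
  assumes \<Delta>: "alg_hom pscale pscale \<Delta>" and \<epsilon>: "alg_hom pscale (*) \<epsilon>"
    and T: "alg_antihom pscale pscale T"
    and left: "\<And>a. conv \<Delta> T (\<lambda>x. x) (gen a) = pscale (\<epsilon> (gen a)) 1"
    and right: "\<And>a. conv \<Delta> (\<lambda>x. x) T (gen a) = pscale (\<epsilon> (gen a)) 1"
  shows "hopf_antipode \<Delta> \<epsilon> T"
proof -
  have T_lin: "lin T" and T_one: "T 1 = 1"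
    using T by (simp_all add: alg_antihom_def)
  note [simp] = alg_homD(2,3)[OF \<epsilon>]
  have e: "lin (\<lambda>h. pscale (\<epsilon> h) 1)"
    by (rule linear_pscaleI) (simp_all add: alg_homD(4,7)[OF \<epsilon>] lin_simps)
  have one: "\<Delta> 1 = basis (0, 0)"
    using alg_homD(2)[OF \<Delta>] by (simp flip: zero_prod_def)
  have words: "conv \<Delta> T (\<lambda>x. x) (basis (Word as)) = pscale (\<epsilon> (basis (Word as))) 1 \<and>
      conv \<Delta> (\<lambda>x. x) T (basis (Word as)) = pscale (\<epsilon> (basis (Word as))) 1" for as
    unfolding basis_Word_eq_prod
  proof (induction as)
    case Nil
    then show ?case by (simp add: conv_def one T_one pscale_one)
  next
    case (Cons a as)
    then show ?case
      using conv_antihom_mult(1)[OF \<Delta> T left] conv_antihom_mult(2)[OF \<Delta> T]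
      by (simp add: right lin_simps mult.commute)
  qed
  have "conv \<Delta> T (\<lambda>x. x) h = pscale (\<epsilon> h) 1" for h
    by (rule linear_eqI'[OF lin_conv[OF alg_homD(1)[OF \<Delta>]] e]) (use words in \<open>metis fmon.exhaust\<close>)
  moreover have "conv \<Delta> (\<lambda>x. x) T h = pscale (\<epsilon> h) 1" for h
    by (rule linear_eqI'[OF lin_conv[OF alg_homD(1)[OF \<Delta>]] e]) (use words in \<open>metis fmon.exhaust\<close>)
  ultimately show ?thesis
    by (simp add: hopf_antipode_def T_lin conv_def)
qed

text \<open>On generators the two identities become those of \<open>coloop_antipode_iff\<close>. In
  the right one \<open>T\<close> reverses the products in the second tensor factor where
  \<open>S\<close> keeps their order, but reversal permutes the weak compositions, so the sums
  agree.\<close>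

lemma hopf_antipode_of_coloop:
  fixes S :: "'f::field fdb \<Rightarrow> 'f fdb"
  assumes S: "coloop_antipode fdb_comult fdb_counit S"
  shows "hopf_antipode nc_comult fdb_counit (fdb_antihom pscale (\<lambda>n. S (X n)))"
proof -
  define T :: "'f fdb \<Rightarrow> 'f fdb" where "T = fdb_antihom pscale (\<lambda>n. S (X n))"
  have S_hom: "alg_hom pscale pscale S"
    using S by (simp add: coloop_antipode_def)
  have T: "alg_antihom pscale pscale T"
    unfolding T_def fdb_antihom_def by (rule alg_antihom_free_antilift[OF scalar_alg_pscale])
  have T_lin: "lin T" and T_one: "T 1 = 1"
    using T by (simp_all add: alg_antihom_def)
  have T_X: "T (X n) = S (X n)" for n
    by (cases "n = 0") (simp_all add: T_one alg_homD(2)[OF S_hom], simp add: T_def scalar_alg_pscale)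
  have T_sum: "T (sum f A) = (\<Sum>x\<in>A. T (f x))" for f :: "nat list \<Rightarrow> _" and A
  proof -
    interpret Vector_Spaces.linear pscale pscale T by (rule T_lin)
    show ?thesis by (rule sum)
  qed
  have rev_sum: "(\<Sum>ks\<in>weak_compositions n l. f (rev ks)) = (\<Sum>ks\<in>weak_compositions n l. f ks)"
    for n l and f :: "nat list \<Rightarrow> 'f fdb"
    by (rule sum.reindex_bij_witness[where i = rev and j = rev]) (auto simp: weak_compositions_def)
  have comp: "fps_map S generic oo generic = fps_X" "generic oo fps_map S generic = fps_X"
    using S coloop_antipode_iff[OF S_hom] by auto
  have conv_X: "conv nc_comult f g (X n) =
      (\<Sum>m=0..n. f (X m) * g (\<Sum>ks\<in>weak_compositions (n - m) (m + 1). prod_list (map X ks)))"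
    if "lin f" "lin g" for f g :: "'f fdb \<Rightarrow> 'f fdb" and n
  proof -
    interpret L: Vector_Spaces.linear pscale pscale "tensor_lift pscale (\<lambda>a b. f a * g b)"
      by (rule linear_tensor_lift)
    show ?thesis
      by (simp only: conv_def nc_comult_X L.sum tensor_lift_tensor[OF bilinear_mult[OF that]])
  qed
  have left: "conv nc_comult T (\<lambda>x. x) (X n) = (fps_map S generic oo generic) $ Suc n" for n
    unfolding conv_X[OF T_lin lin_ident] T_X generic_def fps_map_ser[OF S_hom] ser_compose_nth ..
  have right: "conv nc_comult (\<lambda>x. x) T (X n) = (generic oo fps_map S generic) $ Suc n" for n
  proof -
    have "T (prod_list (map X ks)) = prod_list (map (\<lambda>n. S (X n)) (rev ks))" for ks
      by (simp add: alg_antihom_prod_list[OF T] rev_map o_def T_X)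
    then show ?thesis
      unfolding conv_X[OF lin_ident T_lin] T_sum generic_def fps_map_ser[OF S_hom] ser_compose_nth
      by (simp add: rev_sum[of "\<lambda>ks. prod_list (map (\<lambda>n. S (X n)) ks)"])
  qed
  have unit: "fps_X $ Suc n = pscale (fdb_counit (X n)) (1 :: 'f fdb)" for n
    unfolding fps_map_unit_counit[symmetric] by (simp add: generic_def ser_nth unit_counit_def)
  have gen: "gen a = X (Suc a)" for a
    by (simp add: X_def)
  show ?thesis
    unfolding T_def[symmetric]
    by (rule hopf_antipode_antihomI[OF alg_hom_nc_comult alg_hom_fdb_counit T])
      (simp_all only: gen left right comp unit)
qed

theorem corollary5p5p3:
  shows "(\<exists>!S :: 'f::field fdb \<Rightarrow> 'f fdb. coloop_antipode fdb_comult fdb_counit S)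
    \<and> hopf_algebra (fdb_nc :: (nat fmon, 'f) hopf_data)
    \<and> (fdb_image :: (nat fmon, 'f) hopf_data) = fdb_nc"
proof -
  let ?T = "fdb_antihom pscale (\<lambda>n. fdb_antipode (X n)) :: 'f fdb \<Rightarrow> 'f fdb"
  have "coloop_antipode fdb_comult fdb_counit (fdb_antipode :: 'f fdb \<Rightarrow> 'f fdb)"
    unfolding fdb_antipode_def by (rule theI'[OF ex1_coloop_antipode])
  then have T: "hopf_antipode nc_comult fdb_counit ?T"
    by (rule hopf_antipode_of_coloop)
  \<comment> \<open>Uniqueness identifies the antipode of \<open>fdb_nc\<close>, given by a definite
    description, with the explicit anti-homomorphism in \<open>fdb_image\<close>.\<close>
  then have "(THE S. hopf_antipode nc_comult fdb_counit S) = ?T"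
    by (intro the_equality) (auto intro: hopf_antipode_unique[OF bialgebra_nc])
  then show ?thesis
    using T ex1_coloop_antipode
    by (simp add: hopf_algebra_def fdb_nc_def fdb_image_def bialgebra_nc canonical_proj_fdb_comult)
qed

end
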